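(* Let $(-)^*$ be a monoidal associative contravariant pseudo functor from a category $\mathcal B$ to (suspended, triangulated) symmetric monoidal closed categories, with structure isomorphisms $a_{g,f}:f^*g^*\to(gf)^*$. For any two composable morphisms $f:X\to Y$, $g:Y\to Z$ in $\mathcal B$ and any object $K$ of $\mathcal C_Z$, the isomorphism of functors $a_{g,f}:f^*g^*\to(gf)^*$ is a morphism of duality preserving functors from $$I_{a_{g,f,K}}\{f^*,\beta_{f,g^*K}\}\{g^*,\beta_{g,K}\}\quad\text{to}\quad\{(gf)^*,\beta_{gf,K}\}$$ (both from $(\mathcal C_Z,D_K,\varpi_K)$ to $(\mathcal C_X,D_{(gf)^*K},\varpi_{(gf)^*K})$).
   Context: Closed categories. A symmetric monoidal closed category $(\mathcal C,\otimes)$ (with symmetry $s$) has an internal Hom $[-,-]$ with adjunctions $(-\otimes X)\dashv[X,-]$ natural in $X$, with counit $\mathrm{ev}^l_{X,A}:[X,A]\otimes X\to A$ and unit $\mathrm{coev}^l_{X,A}:A\to[X,A\otimes X]$. Put $\mathrm{ev}^r_{A,K}=\mathrm{ev}^l_{A,K}\circ s:A\otimes[A,K]\to K$. Dualities. For an object $K$, $D_K=[-,K]:\mathcal C\to\mathcal C^o$, with opposite functor $D_K^o$, and $\varpi_K:\mathrm{Id}\to D_K^oD_K$ has component $\varpi_{K,A}:A\to[[A,K],K]$ corresponding to $\mathrm{ev}^r_{A,K}$ under $(-\otimes[A,K])\dashv[[A,K],-]$. A duality preserving functor $\{F,\phi\}:(\mathcal C_1,D_1,\varpi_1)\to(\mathcal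 C_2,D_2,\varpi_2)$ is a functor $F$ and a natural transformation $\phi:FD_1^o\to D_2^oF^o$ (components $\phi_A:FD_1A\to D_2FA$) with $\phi_{D_1A}\circ F(\varpi_{1,A})=D_2(\phi_A)\circ\varpi_{2,FA}$ for all $A$. Composition: $\{F',\phi'\}\{F,\phi\}=\{F'F,\phi'F^o\circ F'\phi\}$. A morphism $\{F,\phi\}\to\{F',\phi'\}$ of duality preserving functors with the same source and target is a natural transformation $\rho:F\to F'$ with $\phi_A=D_2(\rho_A)\circ\phi'_A\circ\rho_{D_1A}$ for all $A$ (in the suspended/triangulated setting, $\rho$ is moreover required to be a morphism of suspended functors). A morphism $\iota:K\to M$ in $\mathcal C$ induces the duality preserving functor $I_\iota=\{\mathrm{Id},\tilde\iota\}:(\mathcal C,D_K,\varpi_K)\to(\mathcal C,D_M,\varpi_M)$, where $\tilde\iota:[-,K]\to[-,M]$ is composition with $\iota$. Monoidal functors. A symmetric monoidal functor $f^*$ comes with a natural isomorphism $\alpha_{A,B}:f^*A\otimes f^*B\to f^*(A\otimes B)$ compatible with associativity and symmetry (and units, when considered). $\beta_{f,K}:f^*D_K^o\to D^o_{f^*K}(f^* )^o$ has components $\beta_{A,K}$: $f^*[A,K]\xrightarrow{\mathrm{coev}^l}[f^*A,f^*[A,K]\otimes f^*A]\xrightarrow{\alpha}[f^*A,f^*([A,K]\otimes A)]\xrightarrow{\mathrm{ev}^l}[f^*A,f^*K]$; $\{f^*,\beta_{f,K}\}$ is a duality preserving functor. Pseudo functors. A contravariant pseudo functor $(-)^*$ on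 $\mathcal B$ assigns to each object $X$ a (suspended, triangulated) symmetric monoidal closed category $\mathcal C_X$, to each $f:X\to Y$ a (suspended, exact) functor $f^*:\mathcal C_Y\to\mathcal C_X$, with identities sent to identities, together with isomorphisms of (suspended) functors $a_{g,f}:f^*g^*\to(gf)^*$ for composable $f,g$. It is associative if the two isomorphisms $f^*g^*h^*\to(hgf)^*$ built from $a$ agree for all composable $f,g,h$. It is monoidal if each $f^*$ is symmetric monoidal and, for composable $f,g$ and all $A,B$, $a_{g,f,A\otimes B}\circ f^*(\alpha^{g}_{A,B})\circ\alpha^{f}_{g^*A,g^*B}=\alpha^{gf}_{A,B}\circ(a_{g,f,A}\otimes a_{g,f,B})$, where $\alpha^f$ denotes the structure isomorphism of $f^*$. Suspended version: a suspended category is an additive category with a functor $T$ having a strict inverse; suspended functors carry isomorphisms $FT\simeq TF$, and morphisms of suspended functors commute with them. In a suspended symmetric monoidal closed category $\otimes$ carries natural isomorphisms $tp_1:TA\otimes B\to T(A\otimes B)$, $tp_2:A\otimes TB\to T(A\otimes B)$ such that the two composites $TA\otimes TB\to T^2(A\otimes B)$ differ by the sign $-1$, compatible with associativity and symmetry; $f^*$ suspended monoidal means $f^*$ is suspended and $\alpha$ commutes with $tp_1,tp_2$. In the triangulated version $f^*$ and $\otimes$ (in both variables) and $[-,-]$ (in the first variable) are moreover exact. *)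

theory Defs
  imports Main
begin

section \<open>Categories, functors, natural transformations\<close>

record ('o, 'm) cat =
  Ob :: "'o set"
  Ar :: "'m set"
  Dom :: "'m \<Rightarrow> 'o"
  Cod :: "'m \<Rightarrow> 'o"
  Idt :: "'o \<Rightarrow> 'm"
  Cmp :: "'m \<Rightarrow> 'm \<Rightarrow> 'm"  (infixr "\<cdot>\<index>" 70)

definition hom :: "('o, 'm, 'z) cat_scheme \<Rightarrow> 'o \<Rightarrow> 'o \<Rightarrow> 'm set" where
  "hom C A B = {h \<in> Ar C. Dom C h = A \<and> Cod C h = B}"

locale category =
  fixes C :: "('o, 'm, 'z) cat_scheme" (structure)
  assumes dom_ob: "h \<in> Ar C \<Longrightarrow> Dom C h \<in> Ob C"
    and cod_ob: "h \<in> Ar C \<Longrightarrow> Cod C h \<in> Ob C"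
    and idt_hom: "A \<in> Ob C \<Longrightarrow> Idt C A \<in> hom C A A"
    and cmp_hom: "h \<in> hom C X Y \<Longrightarrow> k \<in> hom C Y Z \<Longrightarrow> k \<cdot> h \<in> hom C X Z"
    and idt_left: "h \<in> hom C X Y \<Longrightarrow> Idt C Y \<cdot> h = h"
    and idt_right: "h \<in> hom C X Y \<Longrightarrow> h \<cdot> Idt C X = h"
    and cmp_assoc: "h \<in> hom C W X \<Longrightarrow> k \<in> hom C X Y \<Longrightarrow> l \<in> hom C Y Z \<Longrightarrow>
          (l \<cdot> k) \<cdot> h = l \<cdot> (k \<cdot> h)"

definition is_inverse :: "('o, 'm, 'z) cat_scheme \<Rightarrow> 'm \<Rightarrow> 'm \<Rightarrow> bool" where
  "is_inverse C h k \<longleftrightarrow> k \<in> hom C (Cod C h) (Dom C h) \<and>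
     k \<cdot>\<^bsub>C\<^esub> h = Idt C (Dom C h) \<and> h \<cdot>\<^bsub>C\<^esub> k = Idt C (Cod C h)"

definition isos :: "('o, 'm, 'z) cat_scheme \<Rightarrow> 'o \<Rightarrow> 'o \<Rightarrow> 'm set" where
  "isos C A B = {h \<in> hom C A B. \<exists>k. is_inverse C h k}"

definition arr_inv :: "('o, 'm, 'z) cat_scheme \<Rightarrow> 'm \<Rightarrow> 'm" where
  "arr_inv C h = (THE k. is_inverse C h k)"

definition op_cat :: "('o, 'm, 'z) cat_scheme \<Rightarrow> ('o, 'm) cat" where
  "op_cat C = \<lparr>Ob = Ob C, Ar = Ar C, Dom = Cod C, Cod = Dom C, Idt = Idt C,
     Cmp = (\<lambda>k h. h \<cdot>\<^bsub>C\<^esub> k)\<rparr>"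

record ('o, 'm, 'p, 'n) cfunctor =
  fob :: "'o \<Rightarrow> 'p"
  far :: "'m \<Rightarrow> 'n"

text \<open>A functor from \<open>C\<close> to \<open>D\<close> and its opposite, from the opposite of \<open>C\<close> to the opposite of
  \<open>D\<close>, have the same underlying data, and are represented by the same element of \<^typ>\<open>('o, 'm, 'p, 'n) cfunctor\<close>.\<close>

definition is_functor ::
  "('o, 'm, 'y) cat_scheme \<Rightarrow> ('p, 'n, 'z) cat_scheme \<Rightarrow> ('o, 'm, 'p, 'n) cfunctor \<Rightarrow> bool" where
  "is_functor C D F \<longleftrightarrow> category C \<and> category D \<and>
     (\<forall>A \<in> Ob C. fob F A \<in> Ob D) \<and>
     (\<forall>A B. \<forall>h \<in> hom C A B. far F h \<in> hom D (fob F A) (fob F B)) \<and>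
     (\<forall>A \<in> Ob C. far F (Idt C A) = Idt D (fob F A)) \<and>
     (\<forall>X Y Z. \<forall>h \<in> hom C X Y. \<forall>k \<in> hom C Y Z. far F (k \<cdot>\<^bsub>C\<^esub> h) = far F k \<cdot>\<^bsub>D\<^esub> far F h)"

definition id_functor :: "('o, 'm, 'o, 'm) cfunctor" where
  "id_functor = \<lparr>fob = (\<lambda>A. A), far = (\<lambda>h. h)\<rparr>"

definition cmp_functor ::
  "('p, 'n, 'q, 'l) cfunctor \<Rightarrow> ('o, 'm, 'p, 'n) cfunctor \<Rightarrow> ('o, 'm, 'q, 'l) cfunctor"  (infixr "\<circ>\<^sub>F" 70) where
  "G \<circ>\<^sub>F F = \<lparr>fob = (\<lambda>A. fob G (fob F A)), far = (\<lambda>h. far G (far F h))\<rparr>"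

definition nat_trans ::
  "('o, 'm, 'y) cat_scheme \<Rightarrow> ('p, 'n, 'z) cat_scheme \<Rightarrow>
   ('o, 'm, 'p, 'n) cfunctor \<Rightarrow> ('o, 'm, 'p, 'n) cfunctor \<Rightarrow> ('o \<Rightarrow> 'n) \<Rightarrow> bool" where
  "nat_trans C D F G \<eta> \<longleftrightarrow> is_functor C D F \<and> is_functor C D G \<and>
     (\<forall>A \<in> Ob C. \<eta> A \<in> hom D (fob F A) (fob G A)) \<and>
     (\<forall>A B. \<forall>h \<in> hom C A B. \<eta> B \<cdot>\<^bsub>D\<^esub> far F h = far G h \<cdot>\<^bsub>D\<^esub> \<eta> A)"

definition nat_iso ::
  "('o, 'm, 'y) cat_scheme \<Rightarrow> ('p, 'n, 'z) cat_scheme \<Rightarrow>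
   ('o, 'm, 'p, 'n) cfunctor \<Rightarrow> ('o, 'm, 'p, 'n) cfunctor \<Rightarrow> ('o \<Rightarrow> 'n) \<Rightarrow> bool" where
  "nat_iso C D F G \<eta> \<longleftrightarrow> nat_trans C D F G \<eta> \<and> (\<forall>A \<in> Ob C. \<eta> A \<in> isos D (fob F A) (fob G A))"


section \<open>Symmetric monoidal closed categories\<close>

text \<open>The unit is optional: \<open>None\<close> means that no unit is considered, and \<open>Some (I, l, r)\<close> is a
  unit object with its left and right unit isomorphisms.\<close>

record ('o, 'm) smcc = "('o, 'm) cat" +
  tob :: "'o \<Rightarrow> 'o \<Rightarrow> 'o"  (infixl "\<otimes>\<index>" 80)
  tar :: "'m \<Rightarrow> 'm \<Rightarrow> 'm"  (infixl "\<odot>\<index>" 80)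
  assc :: "'o \<Rightarrow> 'o \<Rightarrow> 'o \<Rightarrow> 'm"
  symm :: "'o \<Rightarrow> 'o \<Rightarrow> 'm"
  munit :: "('o \<times> ('o \<Rightarrow> 'm) \<times> ('o \<Rightarrow> 'm)) option"
  hob :: "'o \<Rightarrow> 'o \<Rightarrow> 'o"
  har :: "'m \<Rightarrow> 'm \<Rightarrow> 'm"
  evl :: "'o \<Rightarrow> 'o \<Rightarrow> 'm"
  coevl :: "'o \<Rightarrow> 'o \<Rightarrow> 'm"

locale symmetric_monoidal_category = category C
  for C :: "('o, 'm, 'z) smcc_scheme" (structure) +
  assumes tob_ob: "A \<in> Ob C \<Longrightarrow> B \<in> Ob C \<Longrightarrow> A \<otimes> B \<in> Ob C"
    and tar_hom: "h \<in> hom C A A' \<Longrightarrow> k \<in> hom C B B' \<Longrightarrow> h \<odot> k \<in> hom C (A \<otimes> B) (A' \<otimes> B')"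
    and tar_idt: "A \<in> Ob C \<Longrightarrow> B \<in> Ob C \<Longrightarrow> Idt C A \<odot> Idt C B = Idt C (A \<otimes> B)"
    and tar_cmp: "h \<in> hom C A A' \<Longrightarrow> h' \<in> hom C A' A'' \<Longrightarrow> k \<in> hom C B B' \<Longrightarrow> k' \<in> hom C B' B'' \<Longrightarrow>
          (h' \<cdot> h) \<odot> (k' \<cdot> k) = (h' \<odot> k') \<cdot> (h \<odot> k)"
    and assc_iso: "X \<in> Ob C \<Longrightarrow> Y \<in> Ob C \<Longrightarrow> Z \<in> Ob C \<Longrightarrow>
          assc C X Y Z \<in> isos C ((X \<otimes> Y) \<otimes> Z) (X \<otimes> (Y \<otimes> Z))"
    and assc_nat: "h \<in> hom C X X' \<Longrightarrow> k \<in> hom C Y Y' \<Longrightarrow> l \<in> hom C Z Z' \<Longrightarrow>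
          assc C X' Y' Z' \<cdot> ((h \<odot> k) \<odot> l) = (h \<odot> (k \<odot> l)) \<cdot> assc C X Y Z"
    and symm_hom: "A \<in> Ob C \<Longrightarrow> B \<in> Ob C \<Longrightarrow> symm C A B \<in> hom C (A \<otimes> B) (B \<otimes> A)"
    and symm_nat: "h \<in> hom C A A' \<Longrightarrow> k \<in> hom C B B' \<Longrightarrow>
          symm C A' B' \<cdot> (h \<odot> k) = (k \<odot> h) \<cdot> symm C A B"
    and symm_symm: "A \<in> Ob C \<Longrightarrow> B \<in> Ob C \<Longrightarrow> symm C B A \<cdot> symm C A B = Idt C (A \<otimes> B)"
    and pentagon: "W \<in> Ob C \<Longrightarrow> X \<in> Ob C \<Longrightarrow> Y \<in> Ob C \<Longrightarrow> Z \<in> Ob C \<Longrightarrow>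
          assc C W X (Y \<otimes> Z) \<cdot> assc C (W \<otimes> X) Y Z =
          (Idt C W \<odot> assc C X Y Z) \<cdot> assc C W (X \<otimes> Y) Z \<cdot> (assc C W X Y \<odot> Idt C Z)"
    and hexagon: "X \<in> Ob C \<Longrightarrow> Y \<in> Ob C \<Longrightarrow> Z \<in> Ob C \<Longrightarrow>
          assc C Y Z X \<cdot> symm C X (Y \<otimes> Z) \<cdot> assc C X Y Z =
          (Idt C Y \<odot> symm C X Z) \<cdot> assc C Y X Z \<cdot> (symm C X Y \<odot> Idt C Z)"
    and munit_ob: "munit C = Some (I, lu, ru) \<Longrightarrow> I \<in> Ob C"
    and lunit_iso: "munit C = Some (I, lu, ru) \<Longrightarrow> A \<in> Ob C \<Longrightarrow> lu A \<in> isos C (I \<otimes> A) A"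
    and runit_iso: "munit C = Some (I, lu, ru) \<Longrightarrow> A \<in> Ob C \<Longrightarrow> ru A \<in> isos C (A \<otimes> I) A"
    and lunit_nat: "munit C = Some (I, lu, ru) \<Longrightarrow> h \<in> hom C A B \<Longrightarrow> lu B \<cdot> (Idt C I \<odot> h) = h \<cdot> lu A"
    and runit_nat: "munit C = Some (I, lu, ru) \<Longrightarrow> h \<in> hom C A B \<Longrightarrow> ru B \<cdot> (h \<odot> Idt C I) = h \<cdot> ru A"
    and triangle: "munit C = Some (I, lu, ru) \<Longrightarrow> A \<in> Ob C \<Longrightarrow> B \<in> Ob C \<Longrightarrow>
          (Idt C A \<odot> lu B) \<cdot> assc C A I B = ru A \<odot> Idt C B"
    and unit_symm: "munit C = Some (I, lu, ru) \<Longrightarrow> A \<in> Ob C \<Longrightarrow> lu A \<cdot> symm C A I = ru A"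

text \<open>\<open>hob C X A\<close> is the internal Hom \<open>[X, A]\<close>, contravariant in \<open>X\<close>; \<open>evl C X A\<close> and \<open>coevl C X A\<close>
  are the counit \<open>[X, A] \<otimes> X \<rightarrow> A\<close> and the unit \<open>A \<rightarrow> [X, A \<otimes> X]\<close> of the adjunction between
  \<open>- \<otimes> X\<close> and \<open>[X, -]\<close>.  Naturality of the adjunctions in \<open>X\<close> is \<open>evl_dinat\<close> and \<open>coevl_dinat\<close>.\<close>

locale symmetric_monoidal_closed_category = symmetric_monoidal_category C
  for C :: "('o, 'm, 'z) smcc_scheme" (structure) +
  assumes hob_ob: "X \<in> Ob C \<Longrightarrow> A \<in> Ob C \<Longrightarrow> hob C X A \<in> Ob C"
    and har_hom: "h \<in> hom C X X' \<Longrightarrow> k \<in> hom C A A' \<Longrightarrow> har C h k \<in> hom C (hob C X' A) (hob C X A')"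
    and har_idt: "X \<in> Ob C \<Longrightarrow> A \<in> Ob C \<Longrightarrow> har C (Idt C X) (Idt C A) = Idt C (hob C X A)"
    and har_cmp: "h \<in> hom C X X' \<Longrightarrow> h' \<in> hom C X' X'' \<Longrightarrow> k \<in> hom C A A' \<Longrightarrow> k' \<in> hom C A' A'' \<Longrightarrow>
          har C (h' \<cdot> h) (k' \<cdot> k) = har C h k' \<cdot> har C h' k"
    and evl_hom: "X \<in> Ob C \<Longrightarrow> A \<in> Ob C \<Longrightarrow> evl C X A \<in> hom C (hob C X A \<otimes> X) A"
    and coevl_hom: "X \<in> Ob C \<Longrightarrow> A \<in> Ob C \<Longrightarrow> coevl C X A \<in> hom C A (hob C X (A \<otimes> X))"
    and evl_nat: "X \<in> Ob C \<Longrightarrow> k \<in> hom C A A' \<Longrightarrow>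
          evl C X A' \<cdot> (har C (Idt C X) k \<odot> Idt C X) = k \<cdot> evl C X A"
    and coevl_nat: "X \<in> Ob C \<Longrightarrow> k \<in> hom C A A' \<Longrightarrow>
          coevl C X A' \<cdot> k = har C (Idt C X) (k \<odot> Idt C X) \<cdot> coevl C X A"
    and evl_coevl: "X \<in> Ob C \<Longrightarrow> A \<in> Ob C \<Longrightarrow>
          evl C X (A \<otimes> X) \<cdot> (coevl C X A \<odot> Idt C X) = Idt C (A \<otimes> X)"
    and coevl_evl: "X \<in> Ob C \<Longrightarrow> A \<in> Ob C \<Longrightarrow>
          har C (Idt C X) (evl C X A) \<cdot> coevl C X (hob C X A) = Idt C (hob C X A)"
    and evl_dinat: "h \<in> hom C X X' \<Longrightarrow> A \<in> Ob C \<Longrightarrow>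
          evl C X A \<cdot> (har C h (Idt C A) \<odot> Idt C X) = evl C X' A \<cdot> (Idt C (hob C X' A) \<odot> h)"
    and coevl_dinat: "h \<in> hom C X X' \<Longrightarrow> A \<in> Ob C \<Longrightarrow>
          har C h (Idt C (A \<otimes> X')) \<cdot> coevl C X' A = har C (Idt C X) (Idt C A \<odot> h) \<cdot> coevl C X A"

definition evr :: "('o, 'm, 'z) smcc_scheme \<Rightarrow> 'o \<Rightarrow> 'o \<Rightarrow> 'm" where
  "evr C A K = evl C A K \<cdot>\<^bsub>C\<^esub> symm C A (hob C A K)"

text \<open>The arrow \<open>A \<rightarrow> [X, B]\<close> corresponding to \<open>h : A \<otimes> X \<rightarrow> B\<close>.\<close>

definition hom_transpose :: "('o, 'm, 'z) smcc_scheme \<Rightarrow> 'o \<Rightarrow> 'o \<Rightarrow> 'm \<Rightarrow> 'm" where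
  "hom_transpose C A X h = har C (Idt C X) h \<cdot>\<^bsub>C\<^esub> coevl C X A"

text \<open>\<open>\<alpha>\<close> is the structure isomorphism of the symmetric monoidal functor \<open>F\<close>, and \<open>\<epsilon>\<close> its unit
  isomorphism, which is used only if units are considered on both sides.\<close>

definition symmetric_monoidal_functor ::
  "('o, 'm, 'y) smcc_scheme \<Rightarrow> ('p, 'n, 'z) smcc_scheme \<Rightarrow> ('o, 'm, 'p, 'n) cfunctor \<Rightarrow>
   ('o \<Rightarrow> 'o \<Rightarrow> 'n) \<Rightarrow> 'n \<Rightarrow> bool" where
  "symmetric_monoidal_functor C D F \<alpha> \<epsilon> \<longleftrightarrow>
     symmetric_monoidal_category C \<and> symmetric_monoidal_category D \<and> is_functor C D F \<and>
     (\<forall>A \<in> Ob C. \<forall>B \<in> Ob C. \<alpha> A B \<in> isos D (fob F A \<otimes>\<^bsub>D\<^esub> fob F B) (fob F (A \<otimes>\<^bsub>C\<^esub> B))) \<and>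
     (\<forall>A A' B B'. \<forall>h \<in> hom C A A'. \<forall>k \<in> hom C B B'.
        \<alpha> A' B' \<cdot>\<^bsub>D\<^esub> (far F h \<odot>\<^bsub>D\<^esub> far F k) = far F (h \<odot>\<^bsub>C\<^esub> k) \<cdot>\<^bsub>D\<^esub> \<alpha> A B) \<and>
     (\<forall>X \<in> Ob C. \<forall>Y \<in> Ob C. \<forall>Z \<in> Ob C.
        \<alpha> X (Y \<otimes>\<^bsub>C\<^esub> Z) \<cdot>\<^bsub>D\<^esub> (Idt D (fob F X) \<odot>\<^bsub>D\<^esub> \<alpha> Y Z) \<cdot>\<^bsub>D\<^esub> assc D (fob F X) (fob F Y) (fob F Z) =
        far F (assc C X Y Z) \<cdot>\<^bsub>D\<^esub> \<alpha> (X \<otimes>\<^bsub>C\<^esub> Y) Z \<cdot>\<^bsub>D\<^esub> (\<alpha> X Y \<odot>\<^bsub>D\<^esub> Idt D (fob F Z))) \<and>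
     (\<forall>A \<in> Ob C. \<forall>B \<in> Ob C.
        far F (symm C A B) \<cdot>\<^bsub>D\<^esub> \<alpha> A B = \<alpha> B A \<cdot>\<^bsub>D\<^esub> symm D (fob F A) (fob F B)) \<and>
     (\<forall>I l r J l' r'. munit C = Some (I, l, r) \<longrightarrow> munit D = Some (J, l', r') \<longrightarrow>
        \<epsilon> \<in> isos D J (fob F I) \<and>
        (\<forall>A \<in> Ob C.
           far F (l A) \<cdot>\<^bsub>D\<^esub> \<alpha> I A \<cdot>\<^bsub>D\<^esub> (\<epsilon> \<odot>\<^bsub>D\<^esub> Idt D (fob F A)) = l' (fob F A) \<and>
           far F (r A) \<cdot>\<^bsub>D\<^esub> \<alpha> A I \<cdot>\<^bsub>D\<^esub> (Idt D (fob F A) \<odot>\<^bsub>D\<^esub> \<epsilon>) = r' (fob F A)))"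


section \<open>Suspended categories\<close>

record ('o, 'm) susp =
  addm :: "'m \<Rightarrow> 'm \<Rightarrow> 'm"
  zerom :: "'o \<Rightarrow> 'o \<Rightarrow> 'm"
  negm :: "'m \<Rightarrow> 'm"
  shift :: "('o, 'm, 'o, 'm) cfunctor"
  unshift :: "('o, 'm, 'o, 'm) cfunctor"

abbreviation sh\<^sub>o where "sh\<^sub>o S \<equiv> fob (shift S)"
abbreviation sh\<^sub>a where "sh\<^sub>a S \<equiv> far (shift S)"
abbreviation ush\<^sub>o where "ush\<^sub>o S \<equiv> fob (unshift S)"
abbreviation ush\<^sub>a where "ush\<^sub>a S \<equiv> far (unshift S)"

locale additive_category = category C
  for C :: "('o, 'm, 'y) cat_scheme" (structure) and S :: "('o, 'm, 'z) susp_scheme" +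
  assumes addm_hom: "h \<in> hom C A B \<Longrightarrow> k \<in> hom C A B \<Longrightarrow> addm S h k \<in> hom C A B"
    and zerom_hom: "A \<in> Ob C \<Longrightarrow> B \<in> Ob C \<Longrightarrow> zerom S A B \<in> hom C A B"
    and negm_hom: "h \<in> hom C A B \<Longrightarrow> negm S h \<in> hom C A B"
    and addm_assoc: "h \<in> hom C A B \<Longrightarrow> k \<in> hom C A B \<Longrightarrow> l \<in> hom C A B \<Longrightarrow>
          addm S (addm S h k) l = addm S h (addm S k l)"
    and addm_comm: "h \<in> hom C A B \<Longrightarrow> k \<in> hom C A B \<Longrightarrow> addm S h k = addm S k h"
    and addm_zerom: "h \<in> hom C A B \<Longrightarrow> addm S h (zerom S A B) = h"
    and addm_negm: "h \<in> hom C A B \<Longrightarrow> addm S h (negm S h) = zerom S A B"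
    and cmp_addm_left: "h \<in> hom C X Y \<Longrightarrow> k \<in> hom C Y Z \<Longrightarrow> l \<in> hom C Y Z \<Longrightarrow>
          addm S k l \<cdot> h = addm S (k \<cdot> h) (l \<cdot> h)"
    and cmp_addm_right: "h \<in> hom C X Y \<Longrightarrow> k \<in> hom C X Y \<Longrightarrow> l \<in> hom C Y Z \<Longrightarrow>
          l \<cdot> addm S h k = addm S (l \<cdot> h) (l \<cdot> k)"
    and zero_object: "\<exists>N \<in> Ob C. Idt C N = zerom S N N"
    and biproduct: "A \<in> Ob C \<Longrightarrow> B \<in> Ob C \<Longrightarrow>
          \<exists>Q \<in> Ob C. \<exists>i \<in> hom C A Q. \<exists>j \<in> hom C B Q. \<exists>p \<in> hom C Q A. \<exists>q \<in> hom C Q B.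
            p \<cdot> i = Idt C A \<and> q \<cdot> j = Idt C B \<and> q \<cdot> i = zerom S A B \<and> p \<cdot> j = zerom S B A \<and>
            addm S (i \<cdot> p) (j \<cdot> q) = Idt C Q"

locale suspended_category = additive_category C S
  for C :: "('o, 'm, 'y) cat_scheme" (structure) and S :: "('o, 'm, 'z) susp_scheme" +
  assumes shift_functor: "is_functor C C (shift S)"
    and unshift_functor: "is_functor C C (unshift S)"
    and sh_ush_ob: "A \<in> Ob C \<Longrightarrow> sh\<^sub>o S (ush\<^sub>o S A) = A"
    and ush_sh_ob: "A \<in> Ob C \<Longrightarrow> ush\<^sub>o S (sh\<^sub>o S A) = A"
    and sh_ush_ar: "h \<in> Ar C \<Longrightarrow> sh\<^sub>a S (ush\<^sub>a S h) = h"
    and ush_sh_ar: "h \<in> Ar C \<Longrightarrow> ush\<^sub>a S (sh\<^sub>a S h) = h"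

definition op_susp :: "('o, 'm, 'z) susp_scheme \<Rightarrow> ('o, 'm) susp" where
  "op_susp S = \<lparr>addm = addm S, zerom = (\<lambda>A B. zerom S B A), negm = negm S,
     shift = unshift S, unshift = shift S\<rparr>"

definition suspended_functor ::
  "('o, 'm, 'x) cat_scheme \<Rightarrow> ('o, 'm, 'y) susp_scheme \<Rightarrow> ('p, 'n, 'w) cat_scheme \<Rightarrow> ('p, 'n, 'z) susp_scheme \<Rightarrow>
   ('o, 'm, 'p, 'n) cfunctor \<Rightarrow> ('o \<Rightarrow> 'n) \<Rightarrow> bool" where
  "suspended_functor C S D R F \<theta> \<longleftrightarrow> suspended_category C S \<and> suspended_category D R \<and>
     is_functor C D F \<and> nat_iso C D (F \<circ>\<^sub>F shift S) (shift R \<circ>\<^sub>F F) \<theta>"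

text \<open>The commutation isomorphism \<open>GFT \<rightarrow> TGF\<close> of a composite of suspended functors.\<close>

definition cmp_comm ::
  "('q, 'l, 'z) cat_scheme \<Rightarrow> ('p, 'n, 'q, 'l) cfunctor \<Rightarrow> ('p \<Rightarrow> 'l) \<Rightarrow>
   ('o, 'm, 'p, 'n) cfunctor \<Rightarrow> ('o \<Rightarrow> 'n) \<Rightarrow> 'o \<Rightarrow> 'l" where
  "cmp_comm E G \<kappa> F \<theta> A = \<kappa> (fob F A) \<cdot>\<^bsub>E\<^esub> far G (\<theta> A)"

text \<open>For a suspended functor \<open>F\<close> from \<open>(C, S)\<close> to \<open>(D, R)\<close> with \<open>\<theta> : FT \<rightarrow> TF\<close>, the opposite functor
  is suspended by the arrows \<open>T\<inverse>FA = T\<inverse>FTT\<inverse>A \<rightarrow> T\<inverse>TFT\<inverse>A = FT\<inverse>A\<close> of \<open>D\<close>.\<close>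

definition op_comm ::
  "('o, 'm, 'y) susp_scheme \<Rightarrow> ('p, 'n, 'z) susp_scheme \<Rightarrow> ('o \<Rightarrow> 'n) \<Rightarrow> 'o \<Rightarrow> 'n" where
  "op_comm S R \<theta> A = ush\<^sub>a R (\<theta> (ush\<^sub>o S A))"

definition suspended_nat_trans ::
  "('o, 'm, 'x) cat_scheme \<Rightarrow> ('o, 'm, 'y) susp_scheme \<Rightarrow> ('p, 'n, 'w) cat_scheme \<Rightarrow> ('p, 'n, 'z) susp_scheme \<Rightarrow>
   ('o, 'm, 'p, 'n) cfunctor \<Rightarrow> ('o \<Rightarrow> 'n) \<Rightarrow> ('o, 'm, 'p, 'n) cfunctor \<Rightarrow> ('o \<Rightarrow> 'n) \<Rightarrow> ('o \<Rightarrow> 'n) \<Rightarrow> bool" where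
  "suspended_nat_trans C S D R F \<theta> G \<kappa> \<eta> \<longleftrightarrow> nat_trans C D F G \<eta> \<and>
     (\<forall>A \<in> Ob C. \<kappa> A \<cdot>\<^bsub>D\<^esub> \<eta> (sh\<^sub>o S A) = sh\<^sub>a R (\<eta> A) \<cdot>\<^bsub>D\<^esub> \<theta> A)"

record ('o, 'm) tsusp = "('o, 'm) susp" +
  tp1 :: "'o \<Rightarrow> 'o \<Rightarrow> 'm"
  tp2 :: "'o \<Rightarrow> 'o \<Rightarrow> 'm"

locale suspended_smcc = symmetric_monoidal_closed_category C + suspended_category C S
  for C :: "('o, 'm, 'y) smcc_scheme" (structure) and S :: "('o, 'm, 'z) tsusp_scheme" +
  assumes tp1_iso: "A \<in> Ob C \<Longrightarrow> B \<in> Ob C \<Longrightarrow> tp1 S A B \<in> isos C (sh\<^sub>o S A \<otimes> B) (sh\<^sub>o S (A \<otimes> B))"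
    and tp2_iso: "A \<in> Ob C \<Longrightarrow> B \<in> Ob C \<Longrightarrow> tp2 S A B \<in> isos C (A \<otimes> sh\<^sub>o S B) (sh\<^sub>o S (A \<otimes> B))"
    and tp1_nat: "h \<in> hom C A A' \<Longrightarrow> k \<in> hom C B B' \<Longrightarrow>
          tp1 S A' B' \<cdot> (sh\<^sub>a S h \<odot> k) = sh\<^sub>a S (h \<odot> k) \<cdot> tp1 S A B"
    and tp2_nat: "h \<in> hom C A A' \<Longrightarrow> k \<in> hom C B B' \<Longrightarrow>
          tp2 S A' B' \<cdot> (h \<odot> sh\<^sub>a S k) = sh\<^sub>a S (h \<odot> k) \<cdot> tp2 S A B"
    and tp_anticommute: "A \<in> Ob C \<Longrightarrow> B \<in> Ob C \<Longrightarrow>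
          sh\<^sub>a S (tp2 S A B) \<cdot> tp1 S A (sh\<^sub>o S B) = negm S (sh\<^sub>a S (tp1 S A B) \<cdot> tp2 S (sh\<^sub>o S A) B)"
    and tp_assc_1: "X \<in> Ob C \<Longrightarrow> Y \<in> Ob C \<Longrightarrow> Z \<in> Ob C \<Longrightarrow>
          tp1 S X (Y \<otimes> Z) \<cdot> assc C (sh\<^sub>o S X) Y Z =
          sh\<^sub>a S (assc C X Y Z) \<cdot> tp1 S (X \<otimes> Y) Z \<cdot> (tp1 S X Y \<odot> Idt C Z)"
    and tp_assc_2: "X \<in> Ob C \<Longrightarrow> Y \<in> Ob C \<Longrightarrow> Z \<in> Ob C \<Longrightarrow>
          tp2 S X (Y \<otimes> Z) \<cdot> (Idt C X \<odot> tp1 S Y Z) \<cdot> assc C X (sh\<^sub>o S Y) Z =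
          sh\<^sub>a S (assc C X Y Z) \<cdot> tp1 S (X \<otimes> Y) Z \<cdot> (tp2 S X Y \<odot> Idt C Z)"
    and tp_assc_3: "X \<in> Ob C \<Longrightarrow> Y \<in> Ob C \<Longrightarrow> Z \<in> Ob C \<Longrightarrow>
          tp2 S X (Y \<otimes> Z) \<cdot> (Idt C X \<odot> tp2 S Y Z) \<cdot> assc C X Y (sh\<^sub>o S Z) =
          sh\<^sub>a S (assc C X Y Z) \<cdot> tp2 S (X \<otimes> Y) Z"
    and tp_symm: "A \<in> Ob C \<Longrightarrow> B \<in> Ob C \<Longrightarrow>
          tp2 S B A \<cdot> symm C (sh\<^sub>o S A) B = sh\<^sub>a S (symm C A B) \<cdot> tp1 S A B"

definition suspended_monoidal_functor ::
  "('o, 'm, 'x) smcc_scheme \<Rightarrow> ('o, 'm, 'y) tsusp_scheme \<Rightarrow> ('p, 'n, 'w) smcc_scheme \<Rightarrow> ('p, 'n, 'z) tsusp_scheme \<Rightarrow>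
   ('o, 'm, 'p, 'n) cfunctor \<Rightarrow> ('o \<Rightarrow> 'n) \<Rightarrow> ('o \<Rightarrow> 'o \<Rightarrow> 'n) \<Rightarrow> 'n \<Rightarrow> bool" where
  "suspended_monoidal_functor C S D R F \<theta> \<alpha> \<epsilon> \<longleftrightarrow>
     symmetric_monoidal_functor C D F \<alpha> \<epsilon> \<and> suspended_functor C S D R F \<theta> \<and>
     (\<forall>A \<in> Ob C. \<forall>B \<in> Ob C.
        \<theta> (A \<otimes>\<^bsub>C\<^esub> B) \<cdot>\<^bsub>D\<^esub> far F (tp1 S A B) \<cdot>\<^bsub>D\<^esub> \<alpha> (sh\<^sub>o S A) B =
        sh\<^sub>a R (\<alpha> A B) \<cdot>\<^bsub>D\<^esub> tp1 R (fob F A) (fob F B) \<cdot>\<^bsub>D\<^esub> (\<theta> A \<odot>\<^bsub>D\<^esub> Idt D (fob F B)) \<and>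
        \<theta> (A \<otimes>\<^bsub>C\<^esub> B) \<cdot>\<^bsub>D\<^esub> far F (tp2 S A B) \<cdot>\<^bsub>D\<^esub> \<alpha> A (sh\<^sub>o S B) =
        sh\<^sub>a R (\<alpha> A B) \<cdot>\<^bsub>D\<^esub> tp2 R (fob F A) (fob F B) \<cdot>\<^bsub>D\<^esub> (Idt D (fob F A) \<odot>\<^bsub>D\<^esub> \<theta> B))"


section \<open>Triangulated categories\<close>

text \<open>A triangle \<open>A \<rightarrow> B \<rightarrow> N \<rightarrow> TA\<close> is represented by the triple \<open>(u, v, w)\<close> of its arrows.\<close>

definition triangles :: "('o, 'm, 'y) cat_scheme \<Rightarrow> ('o, 'm, 'z) susp_scheme \<Rightarrow> ('m \<times> 'm \<times> 'm) set" where
  "triangles C S = {(u, v, w). \<exists>A B N. u \<in> hom C A B \<and> v \<in> hom C B N \<and> w \<in> hom C N (sh\<^sub>o S A)}"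

locale triangulated_category = suspended_category C S
  for C :: "('o, 'm, 'y) cat_scheme" (structure) and S :: "('o, 'm, 'z) susp_scheme" +
  fixes \<Delta> :: "('m \<times> 'm \<times> 'm) set"
  assumes exact_triangles: "\<Delta> \<subseteq> triangles C S"
    and exact_iso: "(u, v, w) \<in> \<Delta> \<Longrightarrow> (u', v', w') \<in> triangles C S \<Longrightarrow>
          a \<in> isos C (Dom C u) (Dom C u') \<Longrightarrow> b \<in> isos C (Dom C v) (Dom C v') \<Longrightarrow>
          c \<in> isos C (Dom C w) (Dom C w') \<Longrightarrow>
          b \<cdot> u = u' \<cdot> a \<Longrightarrow> c \<cdot> v = v' \<cdot> b \<Longrightarrow> sh\<^sub>a S a \<cdot> w = w' \<cdot> c \<Longrightarrow> (u', v', w') \<in> \<Delta>"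
    and exact_idt: "A \<in> Ob C \<Longrightarrow> N \<in> Ob C \<Longrightarrow> Idt C N = zerom S N N \<Longrightarrow>
          (Idt C A, zerom S A N, zerom S N (sh\<^sub>o S A)) \<in> \<Delta>"
    and exact_ex: "u \<in> Ar C \<Longrightarrow> \<exists>v w. (u, v, w) \<in> \<Delta>"
    and exact_rotate: "(u, v, w) \<in> triangles C S \<Longrightarrow>
          (u, v, w) \<in> \<Delta> \<longleftrightarrow> (v, w, negm S (sh\<^sub>a S u)) \<in> \<Delta>"
    and exact_mor: "(u, v, w) \<in> \<Delta> \<Longrightarrow> (u', v', w') \<in> \<Delta> \<Longrightarrow>
          a \<in> hom C (Dom C u) (Dom C u') \<Longrightarrow> b \<in> hom C (Dom C v) (Dom C v') \<Longrightarrow> b \<cdot> u = u' \<cdot> a \<Longrightarrow>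
          \<exists>c \<in> hom C (Dom C w) (Dom C w'). c \<cdot> v = v' \<cdot> b \<and> sh\<^sub>a S a \<cdot> w = w' \<cdot> c"
    and octahedron: "u \<in> hom C X Y \<Longrightarrow> v \<in> hom C Y Z \<Longrightarrow>
          (u, j, k) \<in> \<Delta> \<Longrightarrow> (v \<cdot> u, l, m) \<in> \<Delta> \<Longrightarrow> (v, n, i) \<in> \<Delta> \<Longrightarrow>
          \<exists>p q. (p, q, sh\<^sub>a S j \<cdot> i) \<in> \<Delta> \<and>
            p \<in> hom C (Cod C j) (Cod C l) \<and> q \<in> hom C (Cod C l) (Cod C n) \<and>
            p \<cdot> j = l \<cdot> v \<and> m \<cdot> p = k \<and> q \<cdot> l = n \<and> i \<cdot> q = sh\<^sub>a S u \<cdot> m"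

text \<open>A triangle of the opposite category given by \<open>u : B \<rightarrow> A\<close>, \<open>v : N \<rightarrow> B\<close>, \<open>w : T\<inverse>A \<rightarrow> N\<close> in \<open>C\<close> is
  exact if \<open>T\<inverse>A \<rightarrow> N \<rightarrow> B \<rightarrow> A\<close> is exact in \<open>C\<close>.\<close>

definition op_exact :: "('m \<times> 'm \<times> 'm) set \<Rightarrow> ('m \<times> 'm \<times> 'm) set" where
  "op_exact \<Delta> = {(u, v, w). (w, v, u) \<in> \<Delta>}"

definition exact_functor ::
  "('o, 'm, 'x) cat_scheme \<Rightarrow> ('o, 'm, 'y) susp_scheme \<Rightarrow> ('m \<times> 'm \<times> 'm) set \<Rightarrow>
   ('p, 'n, 'w) cat_scheme \<Rightarrow> ('p, 'n, 'z) susp_scheme \<Rightarrow> ('n \<times> 'n \<times> 'n) set \<Rightarrow>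
   ('o, 'm, 'p, 'n) cfunctor \<Rightarrow> ('o \<Rightarrow> 'n) \<Rightarrow> bool" where
  "exact_functor C S \<Delta> D R \<Gamma> F \<theta> \<longleftrightarrow> suspended_functor C S D R F \<theta> \<and>
     (\<forall>(u, v, w) \<in> \<Delta>. (far F u, far F v, \<theta> (Dom C u) \<cdot>\<^bsub>D\<^esub> far F w) \<in> \<Gamma>)"


section \<open>Dualities defined by internal Homs\<close>

text \<open>A duality on \<open>C\<close>: a functor from \<open>C\<close> to its opposite, and the components \<open>A \<rightarrow> DDA\<close>.\<close>

record ('o, 'm) duality =
  dual :: "('o, 'm, 'o, 'm) cfunctor"
  bidual :: "'o \<Rightarrow> 'm"

record ('o, 'm) sduality = "('o, 'm) duality" +
  dual_comm :: "'o \<Rightarrow> 'm"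

definition hom_dual :: "('o, 'm, 'z) smcc_scheme \<Rightarrow> 'o \<Rightarrow> ('o, 'm, 'o, 'm) cfunctor" where
  "hom_dual C K = \<lparr>fob = (\<lambda>A. hob C A K), far = (\<lambda>h. har C h (Idt C K))\<rparr>"

definition hom_bidual :: "('o, 'm, 'z) smcc_scheme \<Rightarrow> 'o \<Rightarrow> 'o \<Rightarrow> 'm" where
  "hom_bidual C K A = hom_transpose C A (hob C A K) (evr C A K)"

text \<open>The suspension of \<open>[-, K]\<close>, as a functor from \<open>C\<close> to its opposite, is the isomorphism
  \<open>T\<inverse>[A, K] \<rightarrow> [TA, K]\<close> corresponding to
  \<open>T\<inverse>[A, K] \<otimes> TA \<rightarrow> T\<inverse>([A, K] \<otimes> TA) \<rightarrow> T\<inverse>T([A, K] \<otimes> A) = [A, K] \<otimes> A \<rightarrow> K\<close>,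
  given by \<open>tp1\<close>, then \<open>tp2\<close>, then evaluation.  Using \<open>tp2\<close> before \<open>tp1\<close> would change the
  sign; with the order chosen here, and the convention of \<open>op_exact\<close>, the functor \<open>[-, K]\<close> is
  exact for complexes with the usual Koszul signs.\<close>

definition hom_dual_comm :: "('o, 'm, 'y) smcc_scheme \<Rightarrow> ('o, 'm, 'z) tsusp_scheme \<Rightarrow> 'o \<Rightarrow> 'o \<Rightarrow> 'm" where
  "hom_dual_comm C S K A =
     (let H = hob C A K; TA = sh\<^sub>o S A; t = arr_inv C (tp1 S (ush\<^sub>o S H) TA)
      in hom_transpose C (ush\<^sub>o S H) TA (evl C A K \<cdot>\<^bsub>C\<^esub> ush\<^sub>a S (tp2 S H A) \<cdot>\<^bsub>C\<^esub> ush\<^sub>a S t))"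

definition hom_duality :: "('o, 'm, 'z) smcc_scheme \<Rightarrow> 'o \<Rightarrow> ('o, 'm) duality" where
  "hom_duality C K = \<lparr>dual = hom_dual C K, bidual = hom_bidual C K\<rparr>"

definition hom_sduality ::
  "('o, 'm, 'y) smcc_scheme \<Rightarrow> ('o, 'm, 'z) tsusp_scheme \<Rightarrow> 'o \<Rightarrow> ('o, 'm) sduality" where
  "hom_sduality C S K =
     \<lparr>dual = hom_dual C K, bidual = hom_bidual C K, dual_comm = hom_dual_comm C S K\<rparr>"

locale triangulated_smcc = suspended_smcc C S + triangulated_category C S \<Delta>
  for C :: "('o, 'm, 'y) smcc_scheme" (structure) and S :: "('o, 'm, 'z) tsusp_scheme"
    and \<Delta> :: "('m \<times> 'm \<times> 'm) set" +
  assumes tensor_left_exact: "X \<in> Ob C \<Longrightarrow>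
          exact_functor C S \<Delta> C S \<Delta> \<lparr>fob = (\<lambda>A. A \<otimes> X), far = (\<lambda>h. h \<odot> Idt C X)\<rparr> (\<lambda>A. tp1 S A X)"
    and tensor_right_exact: "X \<in> Ob C \<Longrightarrow>
          exact_functor C S \<Delta> C S \<Delta> \<lparr>fob = (\<lambda>A. X \<otimes> A), far = (\<lambda>h. Idt C X \<odot> h)\<rparr> (\<lambda>A. tp2 S X A)"
    and hom_exact: "K \<in> Ob C \<Longrightarrow>
          exact_functor C S \<Delta> (op_cat C) (op_susp S) (op_exact \<Delta>) (hom_dual C K) (hom_dual_comm C S K)"


section \<open>Duality preserving functors\<close>

record ('o, 'm, 'p, 'n) dpf =
  dfun :: "('o, 'm, 'p, 'n) cfunctor"
  dnat :: "'o \<Rightarrow> 'n"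

record ('o, 'm, 'p, 'n) sdpf = "('o, 'm, 'p, 'n) dpf" +
  dcomm :: "'o \<Rightarrow> 'n"

definition dp_functor ::
  "('o, 'm, 'v) cat_scheme \<Rightarrow> ('o, 'm, 'w) duality_scheme \<Rightarrow>
   ('p, 'n, 'x) cat_scheme \<Rightarrow> ('p, 'n, 'y) duality_scheme \<Rightarrow> ('o, 'm, 'p, 'n, 'z) dpf_scheme \<Rightarrow> bool" where
  "dp_functor C E C' E' \<Phi> \<longleftrightarrow> is_functor C C' (dfun \<Phi>) \<and>
     nat_trans (op_cat C) C' (dfun \<Phi> \<circ>\<^sub>F dual E) (dual E' \<circ>\<^sub>F dfun \<Phi>) (dnat \<Phi>) \<and>
     (\<forall>A \<in> Ob C. dnat \<Phi> (fob (dual E) A) \<cdot>\<^bsub>C'\<^esub> far (dfun \<Phi>) (bidual E A) =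
        far (dual E') (dnat \<Phi> A) \<cdot>\<^bsub>C'\<^esub> bidual E' (fob (dfun \<Phi>) A))"

definition dp_comp ::
  "('q, 'l, 'x) cat_scheme \<Rightarrow> ('p, 'n, 'q, 'l, 'y) dpf_scheme \<Rightarrow> ('o, 'm, 'p, 'n, 'z) dpf_scheme \<Rightarrow>
   ('o, 'm, 'q, 'l) dpf" where
  "dp_comp C'' \<Psi> \<Phi> = \<lparr>dfun = dfun \<Psi> \<circ>\<^sub>F dfun \<Phi>,
     dnat = (\<lambda>A. dnat \<Psi> (fob (dfun \<Phi>) A) \<cdot>\<^bsub>C''\<^esub> far (dfun \<Psi>) (dnat \<Phi> A))\<rparr>"

definition dp_morphism ::
  "('o, 'm, 'u) cat_scheme \<Rightarrow> ('o, 'm, 'v) duality_scheme \<Rightarrow>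
   ('p, 'n, 'w) cat_scheme \<Rightarrow> ('p, 'n, 'x) duality_scheme \<Rightarrow>
   ('o, 'm, 'p, 'n, 'y) dpf_scheme \<Rightarrow> ('o, 'm, 'p, 'n, 'z) dpf_scheme \<Rightarrow> ('o \<Rightarrow> 'n) \<Rightarrow> bool" where
  "dp_morphism C E C' E' \<Phi> \<Phi>' \<rho> \<longleftrightarrow> dp_functor C E C' E' \<Phi> \<and> dp_functor C E C' E' \<Phi>' \<and>
     nat_trans C C' (dfun \<Phi>) (dfun \<Phi>') \<rho> \<and>
     (\<forall>A \<in> Ob C. dnat \<Phi> A = far (dual E') (\<rho> A) \<cdot>\<^bsub>C'\<^esub> dnat \<Phi>' A \<cdot>\<^bsub>C'\<^esub> \<rho> (fob (dual E) A))"

text \<open>In the suspended version, \<open>\<phi>\<close> is a morphism between the suspended functors \<open>FD\<^sup>o\<close> and \<open>D\<^sup>oF\<^sup>o\<close>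
  from the opposite of \<open>C\<close> to \<open>C'\<close>.\<close>

definition suspended_dp_functor ::
  "('o, 'm, 't) cat_scheme \<Rightarrow> ('o, 'm, 'u) susp_scheme \<Rightarrow> ('o, 'm, 'v) sduality_scheme \<Rightarrow>
   ('p, 'n, 'w) cat_scheme \<Rightarrow> ('p, 'n, 'x) susp_scheme \<Rightarrow> ('p, 'n, 'y) sduality_scheme \<Rightarrow>
   ('o, 'm, 'p, 'n, 'z) sdpf_scheme \<Rightarrow> bool" where
  "suspended_dp_functor C S E C' S' E' \<Phi> \<longleftrightarrow>
     dp_functor C E C' E' \<Phi> \<and> suspended_functor C S C' S' (dfun \<Phi>) (dcomm \<Phi>) \<and>
     suspended_nat_trans (op_cat C) (op_susp S) C' S'
       (dfun \<Phi> \<circ>\<^sub>F dual E)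
       (cmp_comm C' (dfun \<Phi>) (dcomm \<Phi>) (dual E) (op_comm S (op_susp S) (dual_comm E)))
       (dual E' \<circ>\<^sub>F dfun \<Phi>)
       (cmp_comm C' (dual E') (op_comm S' (op_susp S') (dual_comm E')) (dfun \<Phi>) (op_comm S S' (dcomm \<Phi>)))
       (dnat \<Phi>)"

definition suspended_dp_comp ::
  "('q, 'l, 'x) cat_scheme \<Rightarrow> ('p, 'n, 'q, 'l, 'y) sdpf_scheme \<Rightarrow> ('o, 'm, 'p, 'n, 'z) sdpf_scheme \<Rightarrow>
   ('o, 'm, 'q, 'l) sdpf" where
  "suspended_dp_comp C'' \<Psi> \<Phi> =
     dpf.extend (dp_comp C'' \<Psi> \<Phi>) \<lparr>dcomm = cmp_comm C'' (dfun \<Psi>) (dcomm \<Psi>) (dfun \<Phi>) (dcomm \<Phi>)\<rparr>"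

definition suspended_dp_morphism ::
  "('o, 'm, 's) cat_scheme \<Rightarrow> ('o, 'm, 't) susp_scheme \<Rightarrow> ('o, 'm, 'u) sduality_scheme \<Rightarrow>
   ('p, 'n, 'v) cat_scheme \<Rightarrow> ('p, 'n, 'w) susp_scheme \<Rightarrow> ('p, 'n, 'x) sduality_scheme \<Rightarrow>
   ('o, 'm, 'p, 'n, 'y) sdpf_scheme \<Rightarrow> ('o, 'm, 'p, 'n, 'z) sdpf_scheme \<Rightarrow> ('o \<Rightarrow> 'n) \<Rightarrow> bool" where
  "suspended_dp_morphism C S E C' S' E' \<Phi> \<Phi>' \<rho> \<longleftrightarrow>
     suspended_dp_functor C S E C' S' E' \<Phi> \<and> suspended_dp_functor C S E C' S' E' \<Phi>' \<and>
     dp_morphism C E C' E' \<Phi> \<Phi>' \<rho> \<and>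
     suspended_nat_trans C S C' S' (dfun \<Phi>) (dcomm \<Phi>) (dfun \<Phi>') (dcomm \<Phi>') \<rho>"

definition exact_dp_functor ::
  "('o, 'm, 't) cat_scheme \<Rightarrow> ('o, 'm, 'u) susp_scheme \<Rightarrow> ('m \<times> 'm \<times> 'm) set \<Rightarrow> ('o, 'm, 'v) sduality_scheme \<Rightarrow>
   ('p, 'n, 'w) cat_scheme \<Rightarrow> ('p, 'n, 'x) susp_scheme \<Rightarrow> ('n \<times> 'n \<times> 'n) set \<Rightarrow> ('p, 'n, 'y) sduality_scheme \<Rightarrow>
   ('o, 'm, 'p, 'n, 'z) sdpf_scheme \<Rightarrow> bool" where
  "exact_dp_functor C S \<Delta> E C' S' \<Delta>' E' \<Phi> \<longleftrightarrow>
     suspended_dp_functor C S E C' S' E' \<Phi> \<and> exact_functor C S \<Delta> C' S' \<Delta>' (dfun \<Phi>) (dcomm \<Phi>)"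

definition exact_dp_morphism ::
  "('o, 'm, 's) cat_scheme \<Rightarrow> ('o, 'm, 't) susp_scheme \<Rightarrow> ('m \<times> 'm \<times> 'm) set \<Rightarrow> ('o, 'm, 'u) sduality_scheme \<Rightarrow>
   ('p, 'n, 'v) cat_scheme \<Rightarrow> ('p, 'n, 'w) susp_scheme \<Rightarrow> ('n \<times> 'n \<times> 'n) set \<Rightarrow> ('p, 'n, 'x) sduality_scheme \<Rightarrow>
   ('o, 'm, 'p, 'n, 'y) sdpf_scheme \<Rightarrow> ('o, 'm, 'p, 'n, 'z) sdpf_scheme \<Rightarrow> ('o \<Rightarrow> 'n) \<Rightarrow> bool" where
  "exact_dp_morphism C S \<Delta> E C' S' \<Delta>' E' \<Phi> \<Phi>' \<rho> \<longleftrightarrow>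
     exact_dp_functor C S \<Delta> E C' S' \<Delta>' E' \<Phi> \<and> exact_dp_functor C S \<Delta> E C' S' \<Delta>' E' \<Phi>' \<and>
     suspended_dp_morphism C S E C' S' E' \<Phi> \<Phi>' \<rho>"

definition change_dpf :: "('o, 'm, 'z) smcc_scheme \<Rightarrow> 'm \<Rightarrow> ('o, 'm, 'o, 'm) dpf" where
  "change_dpf C \<iota> = \<lparr>dfun = id_functor, dnat = (\<lambda>A. har C (Idt C A) \<iota>)\<rparr>"

definition change_sdpf ::
  "('o, 'm, 'y) smcc_scheme \<Rightarrow> ('o, 'm, 'z) susp_scheme \<Rightarrow> 'm \<Rightarrow> ('o, 'm, 'o, 'm) sdpf" where
  "change_sdpf C S \<iota> = dpf.extend (change_dpf C \<iota>) \<lparr>dcomm = (\<lambda>A. Idt C (sh\<^sub>o S A))\<rparr>"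

definition beta ::
  "('o, 'm, 'y) smcc_scheme \<Rightarrow> ('p, 'n, 'z) smcc_scheme \<Rightarrow> ('o, 'm, 'p, 'n) cfunctor \<Rightarrow>
   ('o \<Rightarrow> 'o \<Rightarrow> 'n) \<Rightarrow> 'o \<Rightarrow> 'o \<Rightarrow> 'n" where
  "beta C D F \<alpha> K A = har D (Idt D (fob F A)) (far F (evl C A K)) \<cdot>\<^bsub>D\<^esub>
     har D (Idt D (fob F A)) (\<alpha> (hob C A K) A) \<cdot>\<^bsub>D\<^esub> coevl D (fob F A) (fob F (hob C A K))"


section \<open>Contravariant pseudo functors\<close>

record ('b, 'f, 'o, 'm) pfun =
  fib :: "'b \<Rightarrow> ('o, 'm) smcc"
  pull :: "'f \<Rightarrow> ('o, 'm, 'o, 'm) cfunctor"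
  mcomp :: "'f \<Rightarrow> 'o \<Rightarrow> 'o \<Rightarrow> 'm"
  ucomp :: "'f \<Rightarrow> 'm"
  acomp :: "'f \<Rightarrow> 'f \<Rightarrow> 'o \<Rightarrow> 'm"

locale pseudo_functor = category B
  for B :: "('b, 'f, 'y) cat_scheme" (structure) +
  fixes P :: "('b, 'f, 'o, 'm, 'z) pfun_scheme"
  assumes fib_smcc: "X \<in> Ob B \<Longrightarrow> symmetric_monoidal_closed_category (fib P X)"
    and pull_functor: "f \<in> hom B X Y \<Longrightarrow> is_functor (fib P Y) (fib P X) (pull P f)"
    and pull_idt_ob: "X \<in> Ob B \<Longrightarrow> A \<in> Ob (fib P X) \<Longrightarrow> fob (pull P (Idt B X)) A = A"
    and pull_idt_ar: "X \<in> Ob B \<Longrightarrow> h \<in> Ar (fib P X) \<Longrightarrow> far (pull P (Idt B X)) h = h"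
    and acomp_iso: "f \<in> hom B X Y \<Longrightarrow> g \<in> hom B Y Z \<Longrightarrow>
          nat_iso (fib P Z) (fib P X) (pull P f \<circ>\<^sub>F pull P g) (pull P (g \<cdot> f)) (acomp P g f)"

locale associative_pseudo_functor = pseudo_functor B P
  for B :: "('b, 'f, 'y) cat_scheme" (structure) and P :: "('b, 'f, 'o, 'm, 'z) pfun_scheme" +
  assumes acomp_assoc: "f \<in> hom B W X \<Longrightarrow> g \<in> hom B X Y \<Longrightarrow> h \<in> hom B Y Z \<Longrightarrow> A \<in> Ob (fib P Z) \<Longrightarrow>
          acomp P (h \<cdot> g) f A \<cdot>\<^bsub>fib P W\<^esub> far (pull P f) (acomp P h g A) =
          acomp P h (g \<cdot> f) A \<cdot>\<^bsub>fib P W\<^esub> acomp P g f (fob (pull P h) A)"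

locale monoidal_pseudo_functor = pseudo_functor B P
  for B :: "('b, 'f, 'y) cat_scheme" (structure) and P :: "('b, 'f, 'o, 'm, 'z) pfun_scheme" +
  assumes pull_monoidal: "f \<in> hom B X Y \<Longrightarrow>
          symmetric_monoidal_functor (fib P Y) (fib P X) (pull P f) (mcomp P f) (ucomp P f)"
    and acomp_mcomp: "f \<in> hom B X Y \<Longrightarrow> g \<in> hom B Y Z \<Longrightarrow> A \<in> Ob (fib P Z) \<Longrightarrow> B' \<in> Ob (fib P Z) \<Longrightarrow>
          acomp P g f (A \<otimes>\<^bsub>fib P Z\<^esub> B') \<cdot>\<^bsub>fib P X\<^esub> far (pull P f) (mcomp P g A B') \<cdot>\<^bsub>fib P X\<^esub>
            mcomp P f (fob (pull P g) A) (fob (pull P g) B') =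
          mcomp P (g \<cdot> f) A B' \<cdot>\<^bsub>fib P X\<^esub> (acomp P g f A \<odot>\<^bsub>fib P X\<^esub> acomp P g f B')"

record ('b, 'f, 'o, 'm) spfun = "('b, 'f, 'o, 'm) pfun" +
  fsusp :: "'b \<Rightarrow> ('o, 'm) tsusp"
  pcomm :: "'f \<Rightarrow> 'o \<Rightarrow> 'm"

locale suspended_pseudo_functor = pseudo_functor B P
  for B :: "('b, 'f, 'y) cat_scheme" (structure) and P :: "('b, 'f, 'o, 'm, 'z) spfun_scheme" +
  assumes fib_suspended: "X \<in> Ob B \<Longrightarrow> suspended_smcc (fib P X) (fsusp P X)"
    and pull_suspended: "f \<in> hom B X Y \<Longrightarrow>
          suspended_functor (fib P Y) (fsusp P Y) (fib P X) (fsusp P X) (pull P f) (pcomm P f)"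
    and pull_idt_comm: "X \<in> Ob B \<Longrightarrow> A \<in> Ob (fib P X) \<Longrightarrow>
          pcomm P (Idt B X) A = Idt (fib P X) (sh\<^sub>o (fsusp P X) A)"
    and acomp_suspended: "f \<in> hom B X Y \<Longrightarrow> g \<in> hom B Y Z \<Longrightarrow>
          suspended_nat_trans (fib P Z) (fsusp P Z) (fib P X) (fsusp P X)
            (pull P f \<circ>\<^sub>F pull P g) (cmp_comm (fib P X) (pull P f) (pcomm P f) (pull P g) (pcomm P g))
            (pull P (g \<cdot> f)) (pcomm P (g \<cdot> f)) (acomp P g f)"

locale suspended_monoidal_pseudo_functor = suspended_pseudo_functor B P + monoidal_pseudo_functor B P
  for B :: "('b, 'f, 'y) cat_scheme" (structure) and P :: "('b, 'f, 'o, 'm, 'z) spfun_scheme" +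
  assumes pull_suspended_monoidal: "f \<in> hom B X Y \<Longrightarrow>
          suspended_monoidal_functor (fib P Y) (fsusp P Y) (fib P X) (fsusp P X)
            (pull P f) (pcomm P f) (mcomp P f) (ucomp P f)"

record ('b, 'f, 'o, 'm) tpfun = "('b, 'f, 'o, 'm) spfun" +
  fexact :: "'b \<Rightarrow> ('m \<times> 'm \<times> 'm) set"

locale triangulated_monoidal_pseudo_functor = suspended_monoidal_pseudo_functor B P
  for B :: "('b, 'f, 'y) cat_scheme" (structure) and P :: "('b, 'f, 'o, 'm, 'z) tpfun_scheme" +
  assumes fib_triangulated: "X \<in> Ob B \<Longrightarrow> triangulated_smcc (fib P X) (fsusp P X) (fexact P X)"
    and pull_exact: "f \<in> hom B X Y \<Longrightarrow>
          exact_functor (fib P Y) (fsusp P Y) (fexact P Y) (fib P X) (fsusp P X) (fexact P X)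
            (pull P f) (pcomm P f)"

text \<open>The duality preserving functor given by the pull-back along \<open>f : X \<rightarrow> Y\<close> and an object \<open>K\<close> over \<open>Y\<close>.\<close>

definition pull_dpf ::
  "('b, 'f, 'y) cat_scheme \<Rightarrow> ('b, 'f, 'o, 'm, 'z) pfun_scheme \<Rightarrow> 'f \<Rightarrow> 'o \<Rightarrow> ('o, 'm, 'o, 'm) dpf" where
  "pull_dpf B P f K = \<lparr>dfun = pull P f,
     dnat = beta (fib P (Cod B f)) (fib P (Dom B f)) (pull P f) (mcomp P f) K\<rparr>"

definition pull_sdpf ::
  "('b, 'f, 'y) cat_scheme \<Rightarrow> ('b, 'f, 'o, 'm, 'z) spfun_scheme \<Rightarrow> 'f \<Rightarrow> 'o \<Rightarrow> ('o, 'm, 'o, 'm) sdpf" where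
  "pull_sdpf B P f K = dpf.extend (pull_dpf B P f K) \<lparr>dcomm = pcomm P f\<rparr>"

end

theory Submission
  imports Defs
begin

text \<open>An arrow \<open>h : A \<rightarrow> [X, B]\<close> is determined by the composite of \<open>h \<otimes> X\<close> with the evaluation, and
  \<open>\<beta>\<close> is the arrow whose composite is \<open>f\<^sup>*(ev) \<circ> \<alpha>\<close>.  Hence the equation for the morphism \<open>a\<close> of duality
  preserving functors can be tested on evaluations, where both sides become
  \<open>(gf)\<^sup>*(ev) \<circ> \<alpha> \<circ> (a \<otimes> a)\<close> by naturality and monoidality of \<open>a\<close>.  The same test shows that the pull-backs
  and the change of the dualizing object preserve the dualities.  For the suspensions one tests with
  the shifted evaluation \<open>T[X, B] \<otimes> X \<rightarrow> T([X, B] \<otimes> X) \<rightarrow> TB\<close>; each side then uses \<open>tp1\<close> or \<open>tp2\<close> alone, so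
  the sign rule never enters.\<close>

section \<open>Categories and functors\<close>

text \<open>A morphism of duality preserving functors includes the claim that both of its ends
  preserve the dualities. Most of the work lies there: besides the one equation between a and
  \<beta>, composition has to be shown to keep the property. The change of the dualizing object is
  forced by types, since the composite for f and g lands in the duality of f*g*K and the other
  functor in that of (gf)*K. In the suspended case the obstacle is that [-, K] goes to the opposite
  category, where the suspension is T\<inverse>. Unfolded, the suspension of [-, K] becomes one
  arrow n : [T\<inverse>A, K] \<rightarrow> T[A, K], characterized by T(ev) \<circ> tp1 \<circ> (n
  \<otimes> A) = T(ev) \<circ> tp2, with the evaluation at A on the left and at T\<inverse>A on the
  right. Thus n trades \<open>tp1\<close> for \<open>tp2\<close>, and a functor compatible with both
  carries the characterization in one category to that in the other.\<close>

context category
begin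

lemma mem_hom_iff: "h \<in> hom C A B \<longleftrightarrow> h \<in> Ar C \<and> Dom C h = A \<and> Cod C h = B"
  by (simp add: hom_def)

lemma Dom_Ob [simp]: "h \<in> Ar C \<Longrightarrow> Dom C h \<in> Ob C"
  and Cod_Ob [simp]: "h \<in> Ar C \<Longrightarrow> Cod C h \<in> Ob C"
  by (simp_all add: dom_ob cod_ob)

lemma Idt_arrow [simp]:
  assumes "A \<in> Ob C"
  shows "Idt C A \<in> Ar C" "Dom C (Idt C A) = A" "Cod C (Idt C A) = A"
  using idt_hom[OF assms] by (simp_all add: hom_def)

lemma Cmp_arrow [simp]:
  assumes "h \<in> Ar C" "k \<in> Ar C" "Dom C k = Cod C h"
  shows "k \<cdot> h \<in> Ar C" "Dom C (k \<cdot> h) = Dom C h" "Cod C (k \<cdot> h) = Cod C k"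
  using cmp_hom[of h "Dom C h" "Cod C h" k "Cod C k"] assms by (simp_all add: hom_def)

lemma Idt_Cmp [simp]: "h \<in> Ar C \<Longrightarrow> Cod C h = A \<Longrightarrow> Idt C A \<cdot> h = h"
  using idt_left[of h "Dom C h" A] by (simp add: hom_def)

lemma Cmp_Idt [simp]: "h \<in> Ar C \<Longrightarrow> Dom C h = A \<Longrightarrow> h \<cdot> Idt C A = h"
  using idt_right[of h A "Cod C h"] by (simp add: hom_def)

lemma Cmp_assoc [simp]:
  assumes "h \<in> Ar C" "k \<in> Ar C" "l \<in> Ar C" "Dom C k = Cod C h" "Dom C l = Cod C k"
  shows "(l \<cdot> k) \<cdot> h = l \<cdot> (k \<cdot> h)"
  using cmp_assoc[of h "Dom C h" "Cod C h" k "Cod C k" l "Cod C l"] assms by (simp add: hom_def)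

text \<open>Composites are kept nested to the right, so an equation
  \<open>l \<cdot> k = l' \<cdot> k'\<close> no longer matches once an arrow precedes
  \<open>k\<close>. The tail \<open>h\<close> restores the match; the typing premises license both
  reassociations.\<close>

lemma Cmp_rewrite:
  assumes "l \<cdot> k = l' \<cdot> k'"
    and "l \<in> Ar C" "k \<in> Ar C" "h \<in> Ar C" "Dom C l = Cod C k" "Dom C k = Cod C h"
    and "l' \<in> Ar C" "k' \<in> Ar C" "Dom C l' = Cod C k'" "Dom C k' = Cod C h"
  shows "l \<cdot> (k \<cdot> h) = l' \<cdot> (k' \<cdot> h)"
  using assms Cmp_assoc[of h k l] Cmp_assoc[of h k' l'] by simp

text \<open>The variant for equations whose right side is one term, such as a triangle
  identity.\<close>

lemma Cmp_rewrite1: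
  assumes "l \<cdot> k = m"
    and "l \<in> Ar C" "k \<in> Ar C" "h \<in> Ar C" "Dom C l = Cod C k" "Dom C k = Cod C h"
  shows "l \<cdot> (k \<cdot> h) = m \<cdot> h"
  using assms Cmp_assoc[of h k l] by simp

lemma iso_cancel_right:
  assumes "t \<in> isos C X Y" "h \<cdot> t = k \<cdot> t"
    and "h \<in> Ar C" "k \<in> Ar C" "Dom C h = Y" "Dom C k = Y"
  shows "h = k"
proof -
  obtain s where "is_inverse C t s" and t: "t \<in> Ar C" "Dom C t = X" "Cod C t = Y"
    using assms(1) by (auto simp: isos_def hom_def)
  then have s: "s \<in> Ar C" "Dom C s = Y" "Cod C s = X" and ts: "t \<cdot> s = Idt C Y"
    by (auto simp: is_inverse_def hom_def)
  have "h = (h \<cdot> t) \<cdot> s" using assms(3-6) s t ts by simp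
  also have "\<dots> = (k \<cdot> t) \<cdot> s" by (simp only: assms(2))
  also have "\<dots> = k" using assms(3-6) s t ts by simp
  finally show ?thesis .
qed

lemma inverse_unique:
  assumes "is_inverse C h k" "is_inverse C h k'" "h \<in> Ar C"
  shows "k = k'"
proof -
  have k: "k \<in> Ar C" "Dom C k = Cod C h" "Cod C k = Dom C h" "h \<cdot> k = Idt C (Cod C h)" "k \<cdot> h = Idt C (Dom C h)"
    and k': "k' \<in> Ar C" "Dom C k' = Cod C h" "Cod C k' = Dom C h" "h \<cdot> k' = Idt C (Cod C h)" "k' \<cdot> h = Idt C (Dom C h)"
    using assms(1,2) by (auto simp: is_inverse_def hom_def)
  have "k = k \<cdot> (h \<cdot> k')" using k k' assms(3) by simp
  also have "\<dots> = (k \<cdot> h) \<cdot> k'" using k(1-3) k'(1-3) assms(3) by simp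
  also have "\<dots> = k'" using k k' assms(3) by simp
  finally show ?thesis .
qed

text \<open>\<open>arr_inv\<close> is a definite description, so it rests on the uniqueness of
  inverses.\<close>

lemma arr_inv_inverse:
  assumes "h \<in> isos C X Y"
  shows "is_inverse C h (arr_inv C h)"
proof -
  obtain k where k: "is_inverse C h k" and h: "h \<in> Ar C"
    using assms by (auto simp: isos_def hom_def)
  then show ?thesis
    unfolding arr_inv_def by (rule_tac theI[of _ k]) (auto intro: inverse_unique)
qed

lemma arr_inv_arrow:
  assumes "h \<in> isos C X Y"
  shows "arr_inv C h \<in> Ar C" "Dom C (arr_inv C h) = Y" "Cod C (arr_inv C h) = X"
    "arr_inv C h \<cdot> h = Idt C X" "h \<cdot> arr_inv C h = Idt C Y"
  using arr_inv_inverse[OF assms] assms by (auto simp: is_inverse_def isos_def hom_def)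

lemma Cmp_isos:
  assumes "h \<in> isos C X Y" "k \<in> isos C Y Z"
  shows "k \<cdot> h \<in> isos C X Z"
proof -
  have h: "h \<in> Ar C" "Dom C h = X" "Cod C h = Y" and k: "k \<in> Ar C" "Dom C k = Y" "Cod C k = Z"
    using assms by (auto simp: isos_def hom_def)
  note h' = arr_inv_arrow[OF assms(1)] and k' = arr_inv_arrow[OF assms(2)]
  have "(arr_inv C h \<cdot> arr_inv C k) \<cdot> (k \<cdot> h) = arr_inv C h \<cdot> ((arr_inv C k \<cdot> k) \<cdot> h)"
    using h k h'(1-3) k'(1-3) by simp
  moreover have "(k \<cdot> h) \<cdot> (arr_inv C h \<cdot> arr_inv C k) = k \<cdot> ((h \<cdot> arr_inv C h) \<cdot> arr_inv C k)"
    using h k h'(1-3) k'(1-3) by simp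
  ultimately have "is_inverse C (k \<cdot> h) (arr_inv C h \<cdot> arr_inv C k)"
    using h k h' k' by (simp add: is_inverse_def hom_def del: Cmp_assoc)
  then show ?thesis using h k by (auto simp: isos_def hom_def)
qed

lemma Idt_isos: "A \<in> Ob C \<Longrightarrow> Idt C A \<in> isos C A A"
  by (auto simp: isos_def hom_def is_inverse_def intro!: exI[of _ "Idt C A"])

end

section \<open>Opposite categories, covariant and contravariant functors\<close>

lemma op_cat_simps [simp]:
  "Ob (op_cat C) = Ob C" "Ar (op_cat C) = Ar C" "Dom (op_cat C) = Cod C" "Cod (op_cat C) = Dom C"
  "Idt (op_cat C) = Idt C" "Cmp (op_cat C) k h = Cmp C h k"
  by (simp_all add: op_cat_def)

lemma hom_op_cat [simp]: "hom (op_cat C) A B = hom C B A"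
  by (auto simp: hom_def)

lemma category_op_cat: "category C \<Longrightarrow> category (op_cat C)"
proof -
  assume "category C"
  then interpret category C .
  show ?thesis by unfold_locales (auto simp: hom_def)
qed

text \<open>Wraps \<open>is_functor\<close> so that typing and functoriality become simplification
  rules wherever a functor is interpreted.\<close>

locale cat_functor =
  fixes C :: "('o, 'm, 'y) cat_scheme" and D :: "('p, 'n, 'z) cat_scheme"
    and F :: "('o, 'm, 'p, 'n) cfunctor"
  assumes is_functor: "is_functor C D F"

sublocale cat_functor \<subseteq> source: category C
  using is_functor by (simp add: is_functor_def)

sublocale cat_functor \<subseteq> target: category D
  using is_functor by (simp add: is_functor_def)

context cat_functor
begin

lemma fob_Ob [simp]: "A \<in> Ob C \<Longrightarrow> fob F A \<in> Ob D"
  using is_functor by (simp add: is_functor_def)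

lemma far_arrow [simp]:
  assumes "h \<in> Ar C"
  shows "far F h \<in> Ar D" "Dom D (far F h) = fob F (Dom C h)" "Cod D (far F h) = fob F (Cod C h)"
  using is_functor assms by (auto simp: is_functor_def hom_def)

lemma far_Idt [simp]: "A \<in> Ob C \<Longrightarrow> far F (Idt C A) = Idt D (fob F A)"
  using is_functor by (simp add: is_functor_def)

lemma far_Cmp [simp]:
  assumes "h \<in> Ar C" "k \<in> Ar C" "Dom C k = Cod C h"
  shows "far F (k \<cdot>\<^bsub>C\<^esub> h) = far F k \<cdot>\<^bsub>D\<^esub> far F h"
  using is_functor assms by (auto simp: is_functor_def hom_def)

lemma far_isos:
  assumes "h \<in> isos C X Y"
  shows "far F h \<in> isos D (fob F X) (fob F Y)"
proof -
  have h: "h \<in> Ar C" "Dom C h = X" "Cod C h = Y" using assms by (auto simp: isos_def hom_def)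
  note k = source.arr_inv_arrow[OF assms]
  have "is_inverse D (far F h) (far F (arr_inv C h))"
    using h k by (simp add: is_inverse_def hom_def flip: far_Cmp) (metis far_Idt source.Cod_Ob source.Dom_Ob)
  then show ?thesis using h by (auto simp: isos_def hom_def)
qed

text \<open>The target of the natural transformation \<phi> applies \<open>F\<close> between
  opposite categories before it applies the dual; this supplies that first factor.\<close>

lemma is_functor_op_cat: "is_functor (op_cat C) (op_cat D) F"
  using is_functor unfolding is_functor_def by (auto simp: category_op_cat)

end

text \<open>The dualities are used through this locale. Its rules speak of arrows of
  \<open>C\<close> itself, with source and target exchanged by \<open>F\<close>, so that
  calculations stay free of \<open>op_cat\<close>.\<close>

locale contra_functor =
  fixes C :: "('o, 'm, 'y) cat_scheme" and D :: "('p, 'n, 'z) cat_scheme"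
    and F :: "('o, 'm, 'p, 'n) cfunctor"
  assumes category: "category C" and is_functor: "is_functor (op_cat C) D F"

sublocale contra_functor \<subseteq> source: category C
  by (rule category)

sublocale contra_functor \<subseteq> target: category D
  using is_functor by (simp add: is_functor_def)

context contra_functor
begin

lemma fob_Ob [simp]: "A \<in> Ob C \<Longrightarrow> fob F A \<in> Ob D"
  using is_functor by (simp add: is_functor_def)

lemma far_arrow [simp]:
  assumes "h \<in> Ar C"
  shows "far F h \<in> Ar D" "Dom D (far F h) = fob F (Cod C h)" "Cod D (far F h) = fob F (Dom C h)"
  using is_functor assms by (auto simp: is_functor_def hom_def)

lemma far_Idt [simp]: "A \<in> Ob C \<Longrightarrow> far F (Idt C A) = Idt D (fob F A)"
  using is_functor by (simp add: is_functor_def)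

lemma far_Cmp [simp]:
  assumes "h \<in> Ar C" "k \<in> Ar C" "Dom C k = Cod C h"
  shows "far F (k \<cdot>\<^bsub>C\<^esub> h) = far F h \<cdot>\<^bsub>D\<^esub> far F k"
  using is_functor assms by (auto simp: is_functor_def hom_def)

end

lemma cmp_functor_simps [simp]:
  "fob (G \<circ>\<^sub>F F) A = fob G (fob F A)" "far (G \<circ>\<^sub>F F) h = far G (far F h)"
  by (simp_all add: cmp_functor_def)

lemma id_functor_simps [simp]: "fob id_functor A = A" "far id_functor h = h"
  by (simp_all add: id_functor_def)

lemma is_functor_cmp: "is_functor C D F \<Longrightarrow> is_functor D E G \<Longrightarrow> is_functor C E (G \<circ>\<^sub>F F)"
  unfolding is_functor_def by simp metis

lemma is_functor_id: "category C \<Longrightarrow> is_functor C C id_functor"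
  by (simp add: is_functor_def)

lemma nat_trans_arrow:
  assumes "nat_trans C D F G \<eta>" "A \<in> Ob C"
  shows "\<eta> A \<in> Ar D" "Dom D (\<eta> A) = fob F A" "Cod D (\<eta> A) = fob G A"
  using assms by (auto simp: nat_trans_def hom_def)

lemma nat_trans_natural:
  assumes "nat_trans C D F G \<eta>" "h \<in> Ar C"
  shows "\<eta> (Cod C h) \<cdot>\<^bsub>D\<^esub> far F h = far G h \<cdot>\<^bsub>D\<^esub> \<eta> (Dom C h)"
  using assms by (auto simp: nat_trans_def hom_def)

lemma nat_transI:
  assumes "is_functor C D F" "is_functor C D G"
    and "\<And>A. A \<in> Ob C \<Longrightarrow> \<eta> A \<in> Ar D \<and> Dom D (\<eta> A) = fob F A \<and> Cod D (\<eta> A) = fob G A"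
    and "\<And>h. h \<in> Ar C \<Longrightarrow> \<eta> (Cod C h) \<cdot>\<^bsub>D\<^esub> far F h = far G h \<cdot>\<^bsub>D\<^esub> \<eta> (Dom C h)"
  shows "nat_trans C D F G \<eta>"
  using assms by (auto simp: nat_trans_def hom_def)

section \<open>Composition of duality preserving functors\<close>

text \<open>Collects the typing of the duality data, which is what the equations for a composite
  consume; the identities relating two biduals come from \<open>dp_functor\<close>.\<close>

definition is_duality :: "('o, 'm, 'y) cat_scheme \<Rightarrow> ('o, 'm, 'z) duality_scheme \<Rightarrow> bool" where
  "is_duality C E \<longleftrightarrow> category C \<and> is_functor (op_cat C) C (dual E) \<and>
     (\<forall>A \<in> Ob C. bidual E A \<in> hom C A (fob (dual E) (fob (dual E) A)))"

lemma dp_functor_comp: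
  assumes E: "is_duality C E" and E': "is_duality C' E'" and E'': "is_duality C'' E''"
    and \<Phi>: "dp_functor C E C' E' \<Phi>" and \<Psi>: "dp_functor C' E' C'' E'' \<Psi>"
  shows "dp_functor C E C'' E'' (dp_comp C'' \<Psi> \<Phi>)"
proof -
  interpret F: cat_functor C C' "dfun \<Phi>" using \<Phi> by unfold_locales (simp add: dp_functor_def)
  interpret G: cat_functor C' C'' "dfun \<Psi>" using \<Psi> by unfold_locales (simp add: dp_functor_def)
  interpret D: contra_functor C C "dual E"
    using E by unfold_locales (auto simp: is_duality_def)
  interpret D': contra_functor C' C' "dual E'"
    using E' by unfold_locales (auto simp: is_duality_def)
  interpret D'': contra_functor C'' C'' "dual E''"
    using E'' by unfold_locales (auto simp: is_duality_def)
  have \<phi>: "nat_trans (op_cat C) C' (dfun \<Phi> \<circ>\<^sub>F dual E) (dual E' \<circ>\<^sub>F dfun \<Phi>) (dnat \<Phi>)"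
    and \<psi>: "nat_trans (op_cat C') C'' (dfun \<Psi> \<circ>\<^sub>F dual E') (dual E'' \<circ>\<^sub>F dfun \<Psi>) (dnat \<Psi>)"
    using \<Phi> \<Psi> by (simp_all add: dp_functor_def)
  note \<phi>a [simp] = nat_trans_arrow[OF \<phi>, simplified] and \<psi>a [simp] = nat_trans_arrow[OF \<psi>, simplified]
  note \<phi>n = nat_trans_natural[OF \<phi>, simplified] and \<psi>n = nat_trans_natural[OF \<psi>, simplified]
  have b [simp]: "bidual E A \<in> Ar C" "Dom C (bidual E A) = A" "Cod C (bidual E A) = fob (dual E) (fob (dual E) A)"
    if "A \<in> Ob C" for A
    using E that by (auto simp: is_duality_def hom_def)
  have b' [simp]: "bidual E' A \<in> Ar C'" "Dom C' (bidual E' A) = A" "Cod C' (bidual E' A) = fob (dual E') (fob (dual E') A)"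
    if "A \<in> Ob C'" for A
    using E' that by (auto simp: is_duality_def hom_def)
  have b'' [simp]: "bidual E'' A \<in> Ar C''" "Dom C'' (bidual E'' A) = A" "Cod C'' (bidual E'' A) = fob (dual E'') (fob (dual E'') A)"
    if "A \<in> Ob C''" for A
    using E'' that by (auto simp: is_duality_def hom_def)
  have nat: "nat_trans (op_cat C) C'' ((dfun \<Psi> \<circ>\<^sub>F dfun \<Phi>) \<circ>\<^sub>F dual E) (dual E'' \<circ>\<^sub>F (dfun \<Psi> \<circ>\<^sub>F dfun \<Phi>))
     (\<lambda>A. dnat \<Psi> (fob (dfun \<Phi>) A) \<cdot>\<^bsub>C''\<^esub> far (dfun \<Psi>) (dnat \<Phi> A))"
  proof (rule nat_transI, goal_cases)
    case 1
    show ?case by (intro is_functor_cmp[OF D.is_functor] is_functor_cmp[OF F.is_functor] G.is_functor)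
  next
    case 2
    show ?case
      by (intro is_functor_cmp[OF _ D''.is_functor] is_functor_cmp[OF F.is_functor_op_cat] G.is_functor_op_cat)
  next
    case (3 A)
    then show ?case by simp
  next
    case (4 h)
    then have h [simp]: "h \<in> Ar C" by simp
    have "dnat \<Psi> (fob (dfun \<Phi>) (Dom C h)) \<cdot>\<^bsub>C''\<^esub> far (dfun \<Psi>) (dnat \<Phi> (Dom C h) \<cdot>\<^bsub>C'\<^esub> far (dfun \<Phi>) (far (dual E) h))
      = dnat \<Psi> (fob (dfun \<Phi>) (Dom C h)) \<cdot>\<^bsub>C''\<^esub> far (dfun \<Psi>) (far (dual E') (far (dfun \<Phi>) h) \<cdot>\<^bsub>C'\<^esub> dnat \<Phi> (Cod C h))"
      by (simp only: \<phi>n h)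
    then show ?case
      using G.target.Cmp_rewrite[OF \<psi>n[of "far (dfun \<Phi>) h"], of "far (dfun \<Psi>) (dnat \<Phi> (Cod C h))"] by simp
  qed
  have bid: "(dnat \<Psi> (fob (dfun \<Phi>) (fob (dual E) A)) \<cdot>\<^bsub>C''\<^esub> far (dfun \<Psi>) (dnat \<Phi> (fob (dual E) A))) \<cdot>\<^bsub>C''\<^esub>
       far (dfun \<Psi>) (far (dfun \<Phi>) (bidual E A)) =
     far (dual E'') (dnat \<Psi> (fob (dfun \<Phi>) A) \<cdot>\<^bsub>C''\<^esub> far (dfun \<Psi>) (dnat \<Phi> A)) \<cdot>\<^bsub>C''\<^esub>
       bidual E'' (fob (dfun \<Psi>) (fob (dfun \<Phi>) A))" if A [simp]: "A \<in> Ob C" for A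
  proof -
    have 1: "dnat \<Phi> (fob (dual E) A) \<cdot>\<^bsub>C'\<^esub> far (dfun \<Phi>) (bidual E A) =
        far (dual E') (dnat \<Phi> A) \<cdot>\<^bsub>C'\<^esub> bidual E' (fob (dfun \<Phi>) A)"
      and 2: "dnat \<Psi> (fob (dual E') (fob (dfun \<Phi>) A)) \<cdot>\<^bsub>C''\<^esub> far (dfun \<Psi>) (bidual E' (fob (dfun \<Phi>) A)) =
        far (dual E'') (dnat \<Psi> (fob (dfun \<Phi>) A)) \<cdot>\<^bsub>C''\<^esub> bidual E'' (fob (dfun \<Psi>) (fob (dfun \<Phi>) A))"
      using \<Phi> \<Psi> by (simp_all add: dp_functor_def)
    have "dnat \<Psi> (fob (dfun \<Phi>) (fob (dual E) A)) \<cdot>\<^bsub>C''\<^esub> far (dfun \<Psi>) (dnat \<Phi> (fob (dual E) A) \<cdot>\<^bsub>C'\<^esub> far (dfun \<Phi>) (bidual E A))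
      = dnat \<Psi> (fob (dfun \<Phi>) (fob (dual E) A)) \<cdot>\<^bsub>C''\<^esub> (far (dfun \<Psi>) (far (dual E') (dnat \<Phi> A)) \<cdot>\<^bsub>C''\<^esub> far (dfun \<Psi>) (bidual E' (fob (dfun \<Phi>) A)))"
      unfolding 1 by simp
    \<comment> \<open>Naturality of \<open>dnat \<Psi>\<close> at the arrow
      \<open>dnat \<Phi> A\<close> exchanges the dual of the middle category for that of the last
      one, which makes the bidual equation of \<Psi> applicable.\<close>
    also have "\<dots> = far (dual E'') (far (dfun \<Psi>) (dnat \<Phi> A)) \<cdot>\<^bsub>C''\<^esub> (dnat \<Psi> (fob (dual E') (fob (dfun \<Phi>) A)) \<cdot>\<^bsub>C''\<^esub> far (dfun \<Psi>) (bidual E' (fob (dfun \<Phi>) A)))"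
      using G.target.Cmp_rewrite[OF \<psi>n[of "dnat \<Phi> A"], of "far (dfun \<Psi>) (bidual E' (fob (dfun \<Phi>) A))"] by simp
    finally show ?thesis unfolding 2 by simp
  qed
  show ?thesis
    using nat bid is_functor_cmp[OF F.is_functor G.is_functor]
    by (simp add: dp_functor_def dp_comp_def)
qed

section \<open>Internal Homs\<close>

context symmetric_monoidal_category
begin

lemma tob_Ob [simp]: "A \<in> Ob C \<Longrightarrow> B \<in> Ob C \<Longrightarrow> A \<otimes> B \<in> Ob C"
  by (rule tob_ob)

lemma tar_arrow [simp]:
  assumes "h \<in> Ar C" "k \<in> Ar C"
  shows "h \<odot> k \<in> Ar C" "Dom C (h \<odot> k) = Dom C h \<otimes> Dom C k" "Cod C (h \<odot> k) = Cod C h \<otimes> Cod C k"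
  using tar_hom[of h "Dom C h" "Cod C h" k "Dom C k" "Cod C k"] assms by (simp_all add: hom_def)

lemma tar_Idt [simp]: "A \<in> Ob C \<Longrightarrow> B \<in> Ob C \<Longrightarrow> Idt C A \<odot> Idt C B = Idt C (A \<otimes> B)"
  by (rule tar_idt)

lemma tar_Cmp:
  assumes "h \<in> Ar C" "h' \<in> Ar C" "k \<in> Ar C" "k' \<in> Ar C" "Dom C h' = Cod C h" "Dom C k' = Cod C k"
  shows "(h' \<odot> k') \<cdot> (h \<odot> k) = (h' \<cdot> h) \<odot> (k' \<cdot> k)"
  using tar_cmp[of h "Dom C h" "Cod C h" h' "Cod C h'" k "Dom C k" "Cod C k" k' "Cod C k'"] assms
  by (simp add: hom_def)

lemma symm_arrow [simp]:
  assumes "A \<in> Ob C" "B \<in> Ob C"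
  shows "symm C A B \<in> Ar C" "Dom C (symm C A B) = A \<otimes> B" "Cod C (symm C A B) = B \<otimes> A"
  using symm_hom[OF assms] by (simp_all add: hom_def)

lemma symm_natural:
  assumes "h \<in> Ar C" "k \<in> Ar C"
  shows "symm C (Cod C h) (Cod C k) \<cdot> (h \<odot> k) = (k \<odot> h) \<cdot> symm C (Dom C h) (Dom C k)"
  using symm_nat assms by (auto simp: hom_def)

end

context symmetric_monoidal_closed_category
begin

lemma hob_Ob [simp]: "X \<in> Ob C \<Longrightarrow> A \<in> Ob C \<Longrightarrow> hob C X A \<in> Ob C"
  by (rule hob_ob)

lemma har_arrow [simp]:
  assumes "h \<in> Ar C" "k \<in> Ar C"
  shows "har C h k \<in> Ar C" "Dom C (har C h k) = hob C (Cod C h) (Dom C k)"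
    "Cod C (har C h k) = hob C (Dom C h) (Cod C k)"
  using har_hom[of h "Dom C h" "Cod C h" k "Dom C k" "Cod C k"] assms by (simp_all add: hom_def)

lemma har_Idt [simp]: "X \<in> Ob C \<Longrightarrow> A \<in> Ob C \<Longrightarrow> har C (Idt C X) (Idt C A) = Idt C (hob C X A)"
  by (rule har_idt)

lemma har_Cmp:
  assumes "h \<in> Ar C" "h' \<in> Ar C" "k \<in> Ar C" "k' \<in> Ar C" "Dom C h' = Cod C h" "Dom C k' = Cod C k"
  shows "har C h k' \<cdot> har C h' k = har C (h' \<cdot> h) (k' \<cdot> k)"
  using har_cmp[of h "Dom C h" "Cod C h" h' "Cod C h'" k "Dom C k" "Cod C k" k' "Cod C k'"] assms
  by (simp add: hom_def)

lemma evl_arrow [simp]: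
  assumes "X \<in> Ob C" "A \<in> Ob C"
  shows "evl C X A \<in> Ar C" "Dom C (evl C X A) = hob C X A \<otimes> X" "Cod C (evl C X A) = A"
  using evl_hom[OF assms] by (simp_all add: hom_def)

lemma coevl_arrow [simp]:
  assumes "X \<in> Ob C" "A \<in> Ob C"
  shows "coevl C X A \<in> Ar C" "Dom C (coevl C X A) = A" "Cod C (coevl C X A) = hob C X (A \<otimes> X)"
  using coevl_hom[OF assms] by (simp_all add: hom_def)

lemma evl_natural:
  assumes "X \<in> Ob C" "k \<in> Ar C"
  shows "evl C X (Cod C k) \<cdot> (har C (Idt C X) k \<odot> Idt C X) = k \<cdot> evl C X (Dom C k)"
  using evl_nat assms by (auto simp: hom_def)

lemma evl_dinatural:
  assumes "h \<in> Ar C" "A \<in> Ob C"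
  shows "evl C (Dom C h) A \<cdot> (har C h (Idt C A) \<odot> Idt C (Dom C h)) =
    evl C (Cod C h) A \<cdot> (Idt C (hob C (Cod C h) A) \<odot> h)"
  using evl_dinat assms by (auto simp: hom_def)

lemma hom_transpose_arrow [simp]:
  assumes "A \<in> Ob C" "X \<in> Ob C" "h \<in> Ar C" "Dom C h = A \<otimes> X"
  shows "hom_transpose C A X h \<in> Ar C" "Dom C (hom_transpose C A X h) = A"
    "Cod C (hom_transpose C A X h) = hob C X (Cod C h)"
  using assms by (simp_all add: hom_transpose_def)

text \<open>The triangle identity \<open>evl_coevl\<close>: naturality of the evaluation pulls
  \<open>h\<close> to the front, and what remains of the transpose cancels.\<close>

lemma evl_hom_transpose:
  assumes A [simp]: "A \<in> Ob C" "X \<in> Ob C" "h \<in> Ar C" "Dom C h = A \<otimes> X"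
  shows "evl C X (Cod C h) \<cdot> (hom_transpose C A X h \<odot> Idt C X) = h"
proof -
  have "hom_transpose C A X h \<odot> Idt C X = (har C (Idt C X) h \<odot> Idt C X) \<cdot> (coevl C X A \<odot> Idt C X)"
    by (simp add: hom_transpose_def tar_Cmp)
  then show ?thesis
    using Cmp_rewrite[OF evl_natural[of X h], of "coevl C X A \<odot> Idt C X"] by (simp add: evl_coevl)
qed

text \<open>The other triangle identity, \<open>coevl_evl\<close>, together with naturality of the
  unit. This direction is what makes evaluation a faithful test for arrows into an internal
  Hom.\<close>

lemma hom_transpose_evl:
  assumes h [simp]: "h \<in> Ar C" "Cod C h = hob C X B" "X \<in> Ob C" "B \<in> Ob C"
  shows "hom_transpose C (Dom C h) X (evl C X B \<cdot> (h \<odot> Idt C X)) = h"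
proof -
  have "hom_transpose C (Dom C h) X (evl C X B \<cdot> (h \<odot> Idt C X)) =
    har C (Idt C X) (evl C X B) \<cdot> (har C (Idt C X) (h \<odot> Idt C X) \<cdot> coevl C X (Dom C h))"
    using har_Cmp[of "Idt C X" "Idt C X" "h \<odot> Idt C X" "evl C X B"]
    by (simp add: hom_transpose_def flip: Cmp_assoc)
  also have "\<dots> = har C (Idt C X) (evl C X B) \<cdot> (coevl C X (hob C X B) \<cdot> h)"
    using coevl_nat[of X h "Dom C h" "hob C X B"] by (simp add: hom_def)
  also have "\<dots> = h"
    using Cmp_rewrite1[OF coevl_evl[of X B], of h] by simp
  finally show ?thesis .
qed

lemma hom_eqI:
  assumes "h \<in> Ar C" "k \<in> Ar C" "Dom C h = Dom C k" "Cod C h = hob C X B" "Cod C k = hob C X B"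
    "X \<in> Ob C" "B \<in> Ob C"
    and "evl C X B \<cdot> (h \<odot> Idt C X) = evl C X B \<cdot> (k \<odot> Idt C X)"
  shows "h = k"
  using hom_transpose_evl[OF assms(1,4,6,7)] hom_transpose_evl[OF assms(2,5,6,7)]
  unfolding assms(3,8) by simp

text \<open>\<open>tar_Cmp\<close> merges tensor factors, so an equation for an evaluation is needed in a form where the
  remaining factors \<open>u\<close> and \<open>x\<close> are still attached.\<close>

lemma evl_har_left:
  assumes [simp]: "X \<in> Ob C" "k \<in> Ar C" "u \<in> Ar C" "x \<in> Ar C" "Cod C u = hob C X (Dom C k)" "Cod C x = X"
  shows "evl C X (Cod C k) \<cdot> ((har C (Idt C X) k \<cdot> u) \<odot> x) = k \<cdot> (evl C X (Dom C k) \<cdot> (u \<odot> x))"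
  using Cmp_rewrite[OF evl_natural[of X k], of "u \<odot> x"] by (simp add: tar_Cmp)

text \<open>The counterpart for the contravariant variable: dinaturality takes \<open>h\<close> out
  of the Hom and attaches it to the tensor factor \<open>x\<close>.\<close>

lemma evl_har_right:
  assumes [simp]: "h \<in> Ar C" "A \<in> Ob C" "u \<in> Ar C" "x \<in> Ar C" "Cod C u = hob C (Cod C h) A" "Cod C x = Dom C h"
  shows "evl C (Dom C h) A \<cdot> ((har C h (Idt C A) \<cdot> u) \<odot> x) = evl C (Cod C h) A \<cdot> (u \<odot> (h \<cdot> x))"
  using Cmp_rewrite[OF evl_dinatural[of h A], of "u \<odot> x"] by (simp add: tar_Cmp)

section \<open>Biduals and the change of the dualizing object\<close>

lemma hom_bidual_arrow [simp]:
  assumes "A \<in> Ob C" "K \<in> Ob C"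
  shows "hom_bidual C K A \<in> Ar C" "Dom C (hom_bidual C K A) = A"
    "Cod C (hom_bidual C K A) = hob C (hob C A K) K"
  using assms by (simp_all add: hom_bidual_def evr_def)

text \<open>The bidual is the transpose of the evaluation after the symmetry. An arrow
  \<open>x\<close> in the Hom factor crosses by naturality of the symmetry and ends up before the
  inner evaluation.\<close>

lemma evl_hom_bidual:
  assumes [simp]: "A \<in> Ob C" "K \<in> Ob C" "x \<in> Ar C" "Cod C x = hob C A K"
  shows "evl C (hob C A K) K \<cdot> (hom_bidual C K A \<odot> x) = evl C A K \<cdot> ((x \<odot> Idt C A) \<cdot> symm C A (Dom C x))"
proof -
  have "evl C (hob C A K) K \<cdot> (hom_bidual C K A \<odot> x) = 
    evl C (hob C A K) K \<cdot> ((hom_bidual C K A \<odot> Idt C (hob C A K)) \<cdot> (Idt C A \<odot> x))"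
    by (simp add: tar_Cmp)
  also have "\<dots> = (evl C A K \<cdot> symm C A (hob C A K)) \<cdot> (Idt C A \<odot> x)"
    using Cmp_rewrite1[of "evl C (hob C A K) K" "hom_bidual C K A \<odot> Idt C (hob C A K)" "evr C A K" "Idt C A \<odot> x"]
      evl_hom_transpose[of A "hob C A K" "evr C A K"]
    by (simp add: evr_def hom_bidual_def)
  also have "\<dots> = evl C A K \<cdot> ((x \<odot> Idt C A) \<cdot> symm C A (Dom C x))"
    using symm_natural[of "Idt C A" x] by simp
  finally show ?thesis .
qed

lemma hom_dual_functor:
  assumes "K \<in> Ob C"
  shows "is_functor (op_cat C) C (hom_dual C K)"
  unfolding is_functor_def using assms category_axioms
  by (auto simp: category_op_cat hom_dual_def mem_hom_iff har_Cmp)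

text \<open>\<open>E\<close> is fixed only through its fields \<open>dual\<close> and
  \<open>bidual\<close>, so the plain and the suspended duality records are both covered.\<close>

lemma hom_duality_is_duality:
  assumes "K \<in> Ob C" "dual E = hom_dual C K" "bidual E = hom_bidual C K"
  shows "is_duality C E"
  using assms category_axioms
  by (auto simp: is_duality_def hom_dual_functor mem_hom_iff) (simp add: hom_dual_def)

text \<open>Tested on evaluations, both sides of the bidual equation become \<iota> \<circ> ev
  \<circ> s. On the left \<iota> comes out of the outer Hom by naturality; on the right dinaturality
  carries [A, \<iota>] into the factor where the bidual is evaluated, and there it meets the inner
  evaluation.\<close>

lemma change_dp_functor:
  assumes \<iota> [simp]: "\<iota> \<in> Ar C" and K: "Dom C \<iota> = K" "Cod C \<iota> = M"
    and E: "dual E = hom_dual C K" "bidual E = hom_bidual C K"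
    and E': "dual E' = hom_dual C M" "bidual E' = hom_bidual C M"
    and \<Phi>: "dfun \<Phi> = id_functor" "dnat \<Phi> = (\<lambda>A. har C (Idt C A) \<iota>)"
  shows "dp_functor C E C E' \<Phi>"
proof -
  have [simp]: "K \<in> Ob C" "M \<in> Ob C" using K \<iota> by auto
  have cat: "is_functor C C id_functor" by (rule is_functor_id) (rule category_axioms)
  have nat: "nat_trans (op_cat C) C (id_functor \<circ>\<^sub>F hom_dual C K) (hom_dual C M \<circ>\<^sub>F id_functor)
     (\<lambda>A. har C (Idt C A) \<iota>)"
  proof (rule nat_transI, goal_cases)
    case 1 show ?case by (rule is_functor_cmp[OF hom_dual_functor cat]) simp
  next
    case 2
    have "is_functor (op_cat C) (op_cat C) id_functor" by (rule is_functor_id) (simp add: category_op_cat category_axioms)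
    then show ?case by (rule is_functor_cmp[OF _ hom_dual_functor]) simp
  next
    case (3 A) then show ?case using K by (simp add: hom_dual_def)
  next
    case (4 h) then show ?case using K by (simp add: hom_dual_def har_Cmp)
  qed
  have "har C (Idt C (hob C A K)) \<iota> \<cdot> hom_bidual C K A =
      har C (har C (Idt C A) \<iota>) (Idt C M) \<cdot> hom_bidual C M A" if [simp]: "A \<in> Ob C" for A
  proof (rule hom_eqI[of _ _ "hob C A K" M])
    have 1: "evl C (hob C A K) M \<cdot> ((har C (Idt C (hob C A K)) \<iota> \<cdot> hom_bidual C K A) \<odot> Idt C (hob C A K)) =
      \<iota> \<cdot> (evl C A K \<cdot> symm C A (hob C A K))"
      using evl_har_left[of "hob C A K" \<iota> "hom_bidual C K A" "Idt C (hob C A K)"] K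
      by (simp add: evl_hom_bidual)
    have "evl C (hob C A K) M \<cdot> ((har C (har C (Idt C A) \<iota>) (Idt C M) \<cdot> hom_bidual C M A) \<odot> Idt C (hob C A K)) =
      evl C A M \<cdot> ((har C (Idt C A) \<iota> \<odot> Idt C A) \<cdot> symm C A (hob C A K))"
      using evl_har_right[of "har C (Idt C A) \<iota>" M "hom_bidual C M A" "Idt C (hob C A K)"] K
      by (simp add: evl_hom_bidual)
    also have "\<dots> = \<iota> \<cdot> (evl C A K \<cdot> symm C A (hob C A K))"
      using Cmp_rewrite[OF evl_natural[of A \<iota>], of "symm C A (hob C A K)"] K by simp
    finally show "evl C (hob C A K) M \<cdot> ((har C (Idt C (hob C A K)) \<iota> \<cdot> hom_bidual C K A) \<odot> Idt C (hob C A K)) =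
      evl C (hob C A K) M \<cdot> ((har C (har C (Idt C A) \<iota>) (Idt C M) \<cdot> hom_bidual C M A) \<odot> Idt C (hob C A K))"
      using 1 by simp
  qed (use K in simp_all)
  then show ?thesis
    using nat cat by (simp add: dp_functor_def E E' \<Phi>) (simp add: hom_dual_def)
qed

end

section \<open>Monoidal functors\<close>

locale closed_monoidal_functor = source: symmetric_monoidal_closed_category C +
  target: symmetric_monoidal_closed_category D
  for C :: "('o, 'm, 'y) smcc_scheme" and D :: "('p, 'n, 'z) smcc_scheme" +
  fixes F :: "('o, 'm, 'p, 'n) cfunctor" and \<alpha> :: "'o \<Rightarrow> 'o \<Rightarrow> 'n" and \<epsilon> :: 'n
  assumes monoidal: "symmetric_monoidal_functor C D F \<alpha> \<epsilon>"

sublocale closed_monoidal_functor \<subseteq> cat_functor C D F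
  using monoidal by unfold_locales (simp add: symmetric_monoidal_functor_def)

context closed_monoidal_functor
begin

lemma mult_arrow [simp]:
  assumes "A \<in> Ob C" "B \<in> Ob C"
  shows "\<alpha> A B \<in> Ar D" "Dom D (\<alpha> A B) = fob F A \<otimes>\<^bsub>D\<^esub> fob F B" "Cod D (\<alpha> A B) = fob F (A \<otimes>\<^bsub>C\<^esub> B)"
  using monoidal assms by (auto simp: symmetric_monoidal_functor_def isos_def hom_def)

lemma mult_natural:
  assumes "h \<in> Ar C" "k \<in> Ar C"
  shows "\<alpha> (Cod C h) (Cod C k) \<cdot>\<^bsub>D\<^esub> (far F h \<odot>\<^bsub>D\<^esub> far F k) = far F (h \<odot>\<^bsub>C\<^esub> k) \<cdot>\<^bsub>D\<^esub> \<alpha> (Dom C h) (Dom C k)"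
  using monoidal assms by (auto simp: symmetric_monoidal_functor_def hom_def)

lemma mult_symm:
  assumes "A \<in> Ob C" "B \<in> Ob C"
  shows "far F (symm C A B) \<cdot>\<^bsub>D\<^esub> \<alpha> A B = \<alpha> B A \<cdot>\<^bsub>D\<^esub> symm D (fob F A) (fob F B)"
  using monoidal assms by (auto simp: symmetric_monoidal_functor_def)

text \<open>Functoriality of the internal Hom in its second variable merges the two
  \<open>har\<close> factors of the definition into one, so that the adjunction applies.\<close>

lemma beta_eq_hom_transpose:
  assumes [simp]: "A \<in> Ob C" "K \<in> Ob C"
  shows "beta C D F \<alpha> K A =
    hom_transpose D (fob F (hob C A K)) (fob F A) (far F (evl C A K) \<cdot>\<^bsub>D\<^esub> \<alpha> (hob C A K) A)"
  using target.har_Cmp[of "Idt D (fob F A)" "Idt D (fob F A)" "\<alpha> (hob C A K) A" "far F (evl C A K)"]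
  by (simp add: beta_def hom_transpose_def flip: target.Cmp_assoc)

lemma beta_arrow [simp]:
  assumes "A \<in> Ob C" "K \<in> Ob C"
  shows "beta C D F \<alpha> K A \<in> Ar D" "Dom D (beta C D F \<alpha> K A) = fob F (hob C A K)"
    "Cod D (beta C D F \<alpha> K A) = hob D (fob F A) (fob F K)"
  using assms by (simp_all add: beta_eq_hom_transpose)

text \<open>The characterization of \<beta> with an arrow \<open>u\<close> before it and
  \<open>x\<close> in the other factor, the shape that \<open>evl_har_left\<close> and
  \<open>evl_har_right\<close> produce.\<close>

lemma evl_beta:
  assumes [simp]: "A \<in> Ob C" "K \<in> Ob C" "u \<in> Ar D" "Cod D u = fob F (hob C A K)" "x \<in> Ar D" "Cod D x = fob F A"
  shows "evl D (fob F A) (fob F K) \<cdot>\<^bsub>D\<^esub> ((beta C D F \<alpha> K A \<cdot>\<^bsub>D\<^esub> u) \<odot>\<^bsub>D\<^esub> x) =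
    far F (evl C A K) \<cdot>\<^bsub>D\<^esub> (\<alpha> (hob C A K) A \<cdot>\<^bsub>D\<^esub> (u \<odot>\<^bsub>D\<^esub> x))"
proof -
  have "evl D (fob F A) (fob F K) \<cdot>\<^bsub>D\<^esub> (beta C D F \<alpha> K A \<odot>\<^bsub>D\<^esub> Idt D (fob F A)) =
    far F (evl C A K) \<cdot>\<^bsub>D\<^esub> \<alpha> (hob C A K) A"
    using target.evl_hom_transpose[of "fob F (hob C A K)" "fob F A" "far F (evl C A K) \<cdot>\<^bsub>D\<^esub> \<alpha> (hob C A K) A"]
    by (simp add: beta_eq_hom_transpose)
  from target.Cmp_rewrite[OF this, of "u \<odot>\<^bsub>D\<^esub> x"] show ?thesis by (simp add: target.tar_Cmp)
qed

lemma pull_dp_functor: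
  assumes K [simp]: "K \<in> Ob C"
    and E: "dual E = hom_dual C K" "bidual E = hom_bidual C K"
    and E': "dual E' = hom_dual D (fob F K)" "bidual E' = hom_bidual D (fob F K)"
    and \<Phi>: "dfun \<Phi> = F" "dnat \<Phi> = beta C D F \<alpha> K"
  shows "dp_functor C E D E' \<Phi>"
proof -
  let ?b = "beta C D F \<alpha> K"
  have nat: "nat_trans (op_cat C) D (F \<circ>\<^sub>F hom_dual C K) (hom_dual D (fob F K) \<circ>\<^sub>F F) ?b"
  proof (rule nat_transI, goal_cases)
    case 1 show ?case by (rule is_functor_cmp[OF source.hom_dual_functor is_functor]) simp
  next
    case 2 show ?case by (rule is_functor_cmp[OF is_functor_op_cat target.hom_dual_functor]) simp
  next
    case (3 A) then show ?case by (simp add: hom_dual_def)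
  next
    case (4 h)
    then have h [simp]: "h \<in> Ar C" by simp
    have "?b (Dom C h) \<cdot>\<^bsub>D\<^esub> far F (har C h (Idt C K)) = har D (far F h) (Idt D (fob F K)) \<cdot>\<^bsub>D\<^esub> ?b (Cod C h)"
    proof (rule target.hom_eqI[of _ _ "fob F (Dom C h)" "fob F K"])
      let ?e = "evl D (fob F (Dom C h)) (fob F K)" and ?i = "Idt D (fob F (Dom C h))"
      have "?e \<cdot>\<^bsub>D\<^esub> ((?b (Dom C h) \<cdot>\<^bsub>D\<^esub> far F (har C h (Idt C K))) \<odot>\<^bsub>D\<^esub> ?i) =
        far F (evl C (Dom C h) K \<cdot>\<^bsub>C\<^esub> (har C h (Idt C K) \<odot>\<^bsub>C\<^esub> Idt C (Dom C h))) \<cdot>\<^bsub>D\<^esub> \<alpha> (hob C (Cod C h) K) (Dom C h)"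
        using mult_natural[of "har C h (Idt C K)" "Idt C (Dom C h)"] by (simp add: evl_beta)
      \<comment> \<open>Dinaturality is used in the source category, inside \<open>F\<close>:
        naturality of \<alpha> has turned a tensor product of images into the image of a tensor
        product, which brings the arrows under one application of \<open>F\<close>.\<close>
      also have "\<dots> = far F (evl C (Cod C h) K \<cdot>\<^bsub>C\<^esub> (Idt C (hob C (Cod C h) K) \<odot>\<^bsub>C\<^esub> h)) \<cdot>\<^bsub>D\<^esub> \<alpha> (hob C (Cod C h) K) (Dom C h)"
        by (simp only: source.evl_dinatural h K)
      also have "\<dots> = ?e \<cdot>\<^bsub>D\<^esub> ((har D (far F h) (Idt D (fob F K)) \<cdot>\<^bsub>D\<^esub> ?b (Cod C h)) \<odot>\<^bsub>D\<^esub> ?i)"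
        using mult_natural[of "Idt C (hob C (Cod C h) K)" h]
          target.evl_har_right[of "far F h" "fob F K" "?b (Cod C h)" ?i]
          evl_beta[of "Cod C h" K "Idt D (fob F (hob C (Cod C h) K))" "far F h"]
        by simp
      finally show "?e \<cdot>\<^bsub>D\<^esub> ((?b (Dom C h) \<cdot>\<^bsub>D\<^esub> far F (har C h (Idt C K))) \<odot>\<^bsub>D\<^esub> ?i) = 
        ?e \<cdot>\<^bsub>D\<^esub> ((har D (far F h) (Idt D (fob F K)) \<cdot>\<^bsub>D\<^esub> ?b (Cod C h)) \<odot>\<^bsub>D\<^esub> ?i)" .
    qed simp_all
    then show ?case by (simp add: hom_dual_def)
  qed
  have "?b (hob C A K) \<cdot>\<^bsub>D\<^esub> far F (hom_bidual C K A) =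
      har D (?b A) (Idt D (fob F K)) \<cdot>\<^bsub>D\<^esub> hom_bidual D (fob F K) (fob F A)" if [simp]: "A \<in> Ob C" for A
  proof (rule target.hom_eqI[of _ _ "fob F (hob C A K)" "fob F K"])
    let ?e = "evl D (fob F (hob C A K)) (fob F K)" and ?i = "Idt D (fob F (hob C A K))"
    have "?e \<cdot>\<^bsub>D\<^esub> ((?b (hob C A K) \<cdot>\<^bsub>D\<^esub> far F (hom_bidual C K A)) \<odot>\<^bsub>D\<^esub> ?i) =
      far F (evl C (hob C A K) K \<cdot>\<^bsub>C\<^esub> (hom_bidual C K A \<odot>\<^bsub>C\<^esub> Idt C (hob C A K))) \<cdot>\<^bsub>D\<^esub> \<alpha> A (hob C A K)"
      using mult_natural[of "hom_bidual C K A" "Idt C (hob C A K)"] by (simp add: evl_beta)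
    \<comment> \<open>Here the symmetry of \<alpha> enters: the bidual of \<open>C\<close>
      contributes the image of a symmetry, and \<open>mult_symm\<close> exchanges it for the
      symmetry of \<open>D\<close> that the bidual of \<open>D\<close> contributes.\<close>
    also have "\<dots> = far F (evl C A K) \<cdot>\<^bsub>D\<^esub> (\<alpha> (hob C A K) A \<cdot>\<^bsub>D\<^esub> symm D (fob F A) (fob F (hob C A K)))"
      by (simp add: source.evl_hom_bidual flip: mult_symm)
    also have "\<dots> = ?e \<cdot>\<^bsub>D\<^esub> ((har D (?b A) (Idt D (fob F K)) \<cdot>\<^bsub>D\<^esub> hom_bidual D (fob F K) (fob F A)) \<odot>\<^bsub>D\<^esub> ?i)"
      using target.evl_har_right[of "?b A" "fob F K" "hom_bidual D (fob F K) (fob F A)" ?i]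
        evl_beta[of A K "Idt D (fob F (hob C A K))" "Idt D (fob F A)"]
        target.Cmp_rewrite[of "evl D (fob F A) (fob F K)" "?b A \<odot>\<^bsub>D\<^esub> Idt D (fob F A)"
          "far F (evl C A K)" "\<alpha> (hob C A K) A" "symm D (fob F A) (fob F (hob C A K))"]
      by (simp add: target.evl_hom_bidual)
    finally show "?e \<cdot>\<^bsub>D\<^esub> ((?b (hob C A K) \<cdot>\<^bsub>D\<^esub> far F (hom_bidual C K A)) \<odot>\<^bsub>D\<^esub> ?i) =
      ?e \<cdot>\<^bsub>D\<^esub> ((har D (?b A) (Idt D (fob F K)) \<cdot>\<^bsub>D\<^esub> hom_bidual D (fob F K) (fob F A)) \<odot>\<^bsub>D\<^esub> ?i)" .
  qed simp_all
  then show ?thesis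
    using nat is_functor by (simp add: dp_functor_def E E' \<Phi>) (simp add: hom_dual_def)
qed

end

section \<open>Suspensions\<close>

sublocale suspended_category \<subseteq> shift: cat_functor C C "shift S"
  by unfold_locales (rule shift_functor)

sublocale suspended_category \<subseteq> unshift: cat_functor C C "unshift S"
  by unfold_locales (rule unshift_functor)

context suspended_category
begin

lemmas shift_unshift [simp] = sh_ush_ob ush_sh_ob sh_ush_ar ush_sh_ar

end

lemma op_susp_simps [simp]:
  "shift (op_susp S) = unshift S" "unshift (op_susp S) = shift S"
  by (simp_all add: op_susp_def)

lemma suspended_functorD:
  assumes "suspended_functor C S D R F \<theta>"
  shows "suspended_category C S" "suspended_category D R" "is_functor C D F"
    "nat_trans C D (F \<circ>\<^sub>F shift S) (shift R \<circ>\<^sub>F F) \<theta>"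
    "A \<in> Ob C \<Longrightarrow> \<theta> A \<in> isos D (fob F (sh\<^sub>o S A)) (sh\<^sub>o R (fob F A))"
  using assms by (auto simp: suspended_functor_def nat_iso_def)

lemma suspended_functor_cmp:
  assumes F: "suspended_functor C S D R F \<theta>" and G: "suspended_functor D R E Q G \<kappa>"
  shows "suspended_functor C S E Q (G \<circ>\<^sub>F F) (cmp_comm E G \<kappa> F \<theta>)"
proof -
  interpret F: cat_functor C D F using suspended_functorD(3)[OF F] by unfold_locales
  interpret G: cat_functor D E G using suspended_functorD(3)[OF G] by unfold_locales
  interpret C: suspended_category C S by (rule suspended_functorD(1)[OF F])
  interpret D: suspended_category D R by (rule suspended_functorD(1)[OF G])
  interpret E: suspended_category E Q by (rule suspended_functorD(2)[OF G])
  note \<theta> = suspended_functorD(4)[OF F] and \<kappa> = suspended_functorD(4)[OF G]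
  note [simp] = nat_trans_arrow[OF \<theta>, simplified] nat_trans_arrow[OF \<kappa>, simplified]
  have nat: "nat_trans C E ((G \<circ>\<^sub>F F) \<circ>\<^sub>F shift S) (shift Q \<circ>\<^sub>F (G \<circ>\<^sub>F F)) (cmp_comm E G \<kappa> F \<theta>)"
  proof (rule nat_transI, goal_cases)
    case 1
    show ?case by (intro is_functor_cmp[OF C.shift.is_functor] is_functor_cmp[OF F.is_functor] G.is_functor)
  next
    case 2
    show ?case by (intro is_functor_cmp[OF _ E.shift.is_functor] is_functor_cmp[OF F.is_functor] G.is_functor)
  next
    case (3 A)
    then show ?case by (simp add: cmp_comm_def)
  next
    case (4 h)
    note h [simp] = this
    have "\<kappa> (fob F (Cod C h)) \<cdot>\<^bsub>E\<^esub> far G (\<theta> (Cod C h) \<cdot>\<^bsub>D\<^esub> far F (sh\<^sub>a S h)) =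
      \<kappa> (fob F (Cod C h)) \<cdot>\<^bsub>E\<^esub> far G (sh\<^sub>a R (far F h) \<cdot>\<^bsub>D\<^esub> \<theta> (Dom C h))"
      using nat_trans_natural[OF \<theta> h] by simp
    then show ?case
      using nat_trans_natural[OF \<kappa>, of "far F h"]
        G.target.Cmp_rewrite[of "\<kappa> (fob F (Cod C h))" "far G (sh\<^sub>a R (far F h))" "sh\<^sub>a Q (far G (far F h))"
          "\<kappa> (fob F (Dom C h))" "far G (\<theta> (Dom C h))"]
      by (simp add: cmp_comm_def)
  qed
  have "cmp_comm E G \<kappa> F \<theta> A \<in> isos E (fob G (fob F (sh\<^sub>o S A))) (sh\<^sub>o Q (fob G (fob F A)))"
    if "A \<in> Ob C" for A
    unfolding cmp_comm_def
    by (rule G.target.Cmp_isos[OF G.far_isos[OF suspended_functorD(5)[OF F that]] suspended_functorD(5)[OF G F.fob_Ob[OF that]]])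
  then show ?thesis
    using nat is_functor_cmp[OF F.is_functor G.is_functor] C.suspended_category_axioms E.suspended_category_axioms
    by (simp add: suspended_functor_def nat_iso_def)
qed

lemma suspended_functor_id:
  assumes "suspended_category C S"
  shows "suspended_functor C S C S id_functor (\<lambda>A. Idt C (sh\<^sub>o S A))"
proof -
  interpret suspended_category C S by fact
  have eq: "id_functor \<circ>\<^sub>F shift S = shift S" "shift S \<circ>\<^sub>F id_functor = shift S"
    by (simp_all add: cmp_functor_def id_functor_def)
  have "nat_trans C C (shift S) (shift S) (\<lambda>A. Idt C (sh\<^sub>o S A))"
    by (rule nat_transI[OF shift.is_functor shift.is_functor]) simp_all
  then show ?thesis
    using assms is_functor_id[OF category_axioms]
    by (simp add: suspended_functor_def nat_iso_def eq Idt_isos)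
qed

section \<open>Suspended dualities and the composition of their functors\<close>

lemma suspended_dp_comp_simps [simp]:
  "dfun (suspended_dp_comp D \<Psi> \<Phi>) = dfun \<Psi> \<circ>\<^sub>F dfun \<Phi>"
  "dnat (suspended_dp_comp D \<Psi> \<Phi>) A = dnat \<Psi> (fob (dfun \<Phi>) A) \<cdot>\<^bsub>D\<^esub> far (dfun \<Psi>) (dnat \<Phi> A)"
  "dcomm (suspended_dp_comp D \<Psi> \<Phi>) = cmp_comm D (dfun \<Psi>) (dcomm \<Psi>) (dfun \<Phi>) (dcomm \<Phi>)"
  by (simp_all add: suspended_dp_comp_def dp_comp_def dpf.defs)

text \<open>The shift of the opposite category is T\<inverse> and its arrows run backwards, hence
  the commutation DT \<rightarrow> T\<inverse>D of the dual is an arrow T\<inverse>DA \<rightarrow>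
  DTA of \<open>C\<close>. As in \<open>is_duality\<close>, types are what is recorded.\<close>

definition is_sduality ::
  "('o, 'm, 'x) cat_scheme \<Rightarrow> ('o, 'm, 'y) susp_scheme \<Rightarrow> ('o, 'm, 'z) sduality_scheme \<Rightarrow> bool" where
  "is_sduality C S E \<longleftrightarrow> is_duality C E \<and>
     (\<forall>A \<in> Ob C. dual_comm E A \<in> hom C (ush\<^sub>o S (fob (dual E) A)) (fob (dual E) (sh\<^sub>o S A)))"

lemma dp_functor_nat:
  "dp_functor C E C' E' \<Phi> \<Longrightarrow> nat_trans (op_cat C) C' (dfun \<Phi> \<circ>\<^sub>F dual E) (dual E' \<circ>\<^sub>F dfun \<Phi>) (dnat \<Phi>)"
  by (simp add: dp_functor_def)

text \<open>\<open>op_comm\<close> into the opposite suspension shifts by T, at the object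
  T\<inverse>A. What remains of the suspension of the dual is
  \<open>sh\<^sub>a S (dual_comm E (ush\<^sub>o S A))\<close>, an arrow DT\<inverse>A \<rightarrow>
  TDA, and the condition is an equation between arrows of the target without any opposite
  category.\<close>

lemma suspended_dp_functor_iff:
  "suspended_dp_functor C S E C' S' E' \<Phi> \<longleftrightarrow>
     dp_functor C E C' E' \<Phi> \<and> suspended_functor C S C' S' (dfun \<Phi>) (dcomm \<Phi>) \<and>
     (\<forall>A \<in> Ob C.
       (sh\<^sub>a S' (dual_comm E' (ush\<^sub>o S' (fob (dfun \<Phi>) A))) \<cdot>\<^bsub>C'\<^esub>
         far (dual E') (ush\<^sub>a S' (dcomm \<Phi> (ush\<^sub>o S A)))) \<cdot>\<^bsub>C'\<^esub> dnat \<Phi> (ush\<^sub>o S A) =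
       sh\<^sub>a S' (dnat \<Phi> A) \<cdot>\<^bsub>C'\<^esub>
         (dcomm \<Phi> (fob (dual E) A) \<cdot>\<^bsub>C'\<^esub> far (dfun \<Phi>) (sh\<^sub>a S (dual_comm E (ush\<^sub>o S A)))))"
  by (auto simp: suspended_dp_functor_def suspended_nat_trans_def cmp_comm_def op_comm_def dp_functor_nat)

lemma suspended_dp_functor_comp:
  assumes E: "is_sduality C S E" and E': "is_sduality C' S' E'" and E'': "is_sduality C'' S'' E''"
    and \<Phi>: "suspended_dp_functor C S E C' S' E' \<Phi>" and \<Psi>: "suspended_dp_functor C' S' E' C'' S'' E'' \<Psi>"
  shows "suspended_dp_functor C S E C'' S'' E'' (suspended_dp_comp C'' \<Psi> \<Phi>)"
proof -
  let ?F = "dfun \<Phi>" and ?G = "dfun \<Psi>" and ?d = "dcomm \<Phi>" and ?d' = "dcomm \<Psi>"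
  have dp: "dp_functor C E C' E' \<Phi>" "dp_functor C' E' C'' E'' \<Psi>"
    and sf: "suspended_functor C S C' S' ?F ?d" "suspended_functor C' S' C'' S'' ?G ?d'"
    using \<Phi> \<Psi> by (simp_all add: suspended_dp_functor_def)
  have dual: "is_duality C E" "is_duality C' E'" "is_duality C'' E''"
    using E E' E'' by (simp_all add: is_sduality_def)
  interpret F: cat_functor C C' ?F by unfold_locales (rule suspended_functorD(3)[OF sf(1)])
  interpret G: cat_functor C' C'' ?G by unfold_locales (rule suspended_functorD(3)[OF sf(2)])
  interpret C: suspended_category C S by (rule suspended_functorD(1)[OF sf(1)])
  interpret C': suspended_category C' S' by (rule suspended_functorD(1)[OF sf(2)])
  interpret C'': suspended_category C'' S'' by (rule suspended_functorD(2)[OF sf(2)])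
  interpret D: contra_functor C C "dual E"
    using dual(1) by unfold_locales (auto simp: is_duality_def)
  interpret D': contra_functor C' C' "dual E'"
    using dual(2) by unfold_locales (auto simp: is_duality_def)
  interpret D'': contra_functor C'' C'' "dual E''"
    using dual(3) by unfold_locales (auto simp: is_duality_def)
  note [simp] = nat_trans_arrow[OF suspended_functorD(4)[OF sf(1)], simplified]
    nat_trans_arrow[OF suspended_functorD(4)[OF sf(2)], simplified]
    nat_trans_arrow[OF dp_functor_nat[OF dp(1)], simplified]
    nat_trans_arrow[OF dp_functor_nat[OF dp(2)], simplified]
  note \<psi>n = nat_trans_natural[OF dp_functor_nat[OF dp(2)], simplified]
    and d'n = nat_trans_natural[OF suspended_functorD(4)[OF sf(2)], simplified]
  have c [simp]: "dual_comm E A \<in> Ar C" "Dom C (dual_comm E A) = ush\<^sub>o S (fob (dual E) A)"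
    "Cod C (dual_comm E A) = fob (dual E) (sh\<^sub>o S A)" if "A \<in> Ob C" for A
    using E that by (auto simp: is_sduality_def hom_def)
  have c' [simp]: "dual_comm E' A \<in> Ar C'" "Dom C' (dual_comm E' A) = ush\<^sub>o S' (fob (dual E') A)"
    "Cod C' (dual_comm E' A) = fob (dual E') (sh\<^sub>o S' A)" if "A \<in> Ob C'" for A
    using E' that by (auto simp: is_sduality_def hom_def)
  have c'' [simp]: "dual_comm E'' A \<in> Ar C''" "Dom C'' (dual_comm E'' A) = ush\<^sub>o S'' (fob (dual E'') A)"
    "Cod C'' (dual_comm E'' A) = fob (dual E'') (sh\<^sub>o S'' A)" if "A \<in> Ob C''" for A
    using E'' that by (auto simp: is_sduality_def hom_def)
  have "(sh\<^sub>a S'' (dual_comm E'' (ush\<^sub>o S'' (fob (?G \<circ>\<^sub>F ?F) A))) \<cdot>\<^bsub>C''\<^esub>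
      far (dual E'') (ush\<^sub>a S'' (cmp_comm C'' ?G ?d' ?F ?d (ush\<^sub>o S A)))) \<cdot>\<^bsub>C''\<^esub>
        (dnat \<Psi> (fob ?F (ush\<^sub>o S A)) \<cdot>\<^bsub>C''\<^esub> far ?G (dnat \<Phi> (ush\<^sub>o S A))) =
    sh\<^sub>a S'' (dnat \<Psi> (fob ?F A) \<cdot>\<^bsub>C''\<^esub> far ?G (dnat \<Phi> A)) \<cdot>\<^bsub>C''\<^esub>
         (cmp_comm C'' ?G ?d' ?F ?d (fob (dual E) A) \<cdot>\<^bsub>C''\<^esub> far (?G \<circ>\<^sub>F ?F) (sh\<^sub>a S (dual_comm E (ush\<^sub>o S A))))"
    (is "?L = ?R") if [simp]: "A \<in> Ob C" for A
  proof -
    let ?B = "ush\<^sub>o S A"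
    let ?dB = "?d ?B" and ?FA = "fob ?F A"
    let ?dB' = "?d' (ush\<^sub>o S' ?FA)"
    let ?n = "sh\<^sub>a S (dual_comm E ?B)"
      and ?n' = "sh\<^sub>a S' (dual_comm E' (ush\<^sub>o S' ?FA))"
      and ?n'' = "sh\<^sub>a S'' (dual_comm E'' (ush\<^sub>o S'' (fob ?G ?FA)))"
    let ?t = "ush\<^sub>a S' ?dB" and ?t' = "ush\<^sub>a S'' ?dB'"
    have 1: "(?n' \<cdot>\<^bsub>C'\<^esub> far (dual E') ?t) \<cdot>\<^bsub>C'\<^esub> dnat \<Phi> ?B =
        sh\<^sub>a S' (dnat \<Phi> A) \<cdot>\<^bsub>C'\<^esub> (?d (fob (dual E) A) \<cdot>\<^bsub>C'\<^esub> far ?F ?n)"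
      using \<Phi> by (simp add: suspended_dp_functor_iff del: F.target.Cmp_assoc)
    have 2: "(?n'' \<cdot>\<^bsub>C''\<^esub> far (dual E'') ?t') \<cdot>\<^bsub>C''\<^esub> dnat \<Psi> (ush\<^sub>o S' ?FA) =
        sh\<^sub>a S'' (dnat \<Psi> ?FA) \<cdot>\<^bsub>C''\<^esub> (?d' (fob (dual E') ?FA) \<cdot>\<^bsub>C''\<^esub> far ?G ?n')"
      using \<Psi> by (simp add: suspended_dp_functor_iff del: G.target.Cmp_assoc)
    \<comment> \<open>The arrow \<open>?dB\<close> is the shift of \<open>?t\<close>, so naturality
      of \<open>?d'\<close> at \<open>?t\<close> applies. After T\<inverse> the commutation of the
      composite splits into the parts \<open>far ?G ?t\<close> and \<open>?t'\<close> of the single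
      functors.\<close>
    have "ush\<^sub>a S'' (cmp_comm C'' ?G ?d' ?F ?d ?B) = ush\<^sub>a S'' (sh\<^sub>a S'' (far ?G ?t) \<cdot>\<^bsub>C''\<^esub> ?dB')"
      using d'n[of ?t] by (simp add: cmp_comm_def del: C''.unshift.far_Cmp)
    then have t: "ush\<^sub>a S'' (cmp_comm C'' ?G ?d' ?F ?d ?B) = far ?G ?t \<cdot>\<^bsub>C''\<^esub> ?t'"
      by simp
    have "?L = ?n'' \<cdot>\<^bsub>C''\<^esub> (far (dual E'') ?t' \<cdot>\<^bsub>C''\<^esub> (far (dual E'') (far ?G ?t) \<cdot>\<^bsub>C''\<^esub>
        (dnat \<Psi> (fob ?F ?B) \<cdot>\<^bsub>C''\<^esub> far ?G (dnat \<Phi> ?B))))"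
      by (simp add: t)
    \<comment> \<open>Naturality of \<open>dnat \<Psi>\<close> at \<open>?t\<close> separates the
      factors: those of the second functor stand in front, those of the first are collected under
      \<open>?G\<close>. Equations \<open>2\<close> and \<open>1\<close> then apply in turn.\<close>
    also have "\<dots> = ((?n'' \<cdot>\<^bsub>C''\<^esub> far (dual E'') ?t') \<cdot>\<^bsub>C''\<^esub> dnat \<Psi> (ush\<^sub>o S' ?FA)) \<cdot>\<^bsub>C''\<^esub>
        far ?G (far (dual E') ?t \<cdot>\<^bsub>C'\<^esub> dnat \<Phi> ?B)"
      using G.target.Cmp_rewrite[OF \<psi>n[of ?t], of "far ?G (dnat \<Phi> ?B)"] by simp
    also have "\<dots> = (sh\<^sub>a S'' (dnat \<Psi> ?FA) \<cdot>\<^bsub>C''\<^esub> ?d' (fob (dual E') ?FA)) \<cdot>\<^bsub>C''\<^esub>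
        far ?G ((?n' \<cdot>\<^bsub>C'\<^esub> far (dual E') ?t) \<cdot>\<^bsub>C'\<^esub> dnat \<Phi> ?B)"
      unfolding 2 by simp
    \<comment> \<open>Naturality of \<open>?d'\<close> at \<open>dnat \<Phi> A\<close> brings the
      shifted image of \<open>dnat \<Phi> A\<close> next to that of
      \<open>dnat \<Psi>\<close>.\<close>
    also have "\<dots> = ?R"
      unfolding 1 using G.target.Cmp_rewrite[OF d'n[of "dnat \<Phi> A"], of "far ?G (?d (fob (dual E) A) \<cdot>\<^bsub>C'\<^esub> far ?F ?n)"]
      by (simp add: cmp_comm_def)
    finally show ?thesis .
  qed
  moreover have "dp_functor C E C'' E'' (suspended_dp_comp C'' \<Psi> \<Phi>)"
    using dp_functor_comp[OF dual dp] by (simp add: dp_functor_def) (simp add: dp_comp_def suspended_dp_comp_def dpf.defs)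
  ultimately show ?thesis
    using suspended_functor_cmp[OF sf] by (simp add: suspended_dp_functor_iff)
qed

section \<open>Suspended internal Homs\<close>

context suspended_smcc
begin

lemma tp_arrow [simp]:
  assumes "A \<in> Ob C" "B \<in> Ob C"
  shows "tp1 S A B \<in> Ar C" "Dom C (tp1 S A B) = sh\<^sub>o S A \<otimes> B" "Cod C (tp1 S A B) = sh\<^sub>o S (A \<otimes> B)"
    "tp2 S A B \<in> Ar C" "Dom C (tp2 S A B) = A \<otimes> sh\<^sub>o S B" "Cod C (tp2 S A B) = sh\<^sub>o S (A \<otimes> B)"
  using tp1_iso[OF assms] tp2_iso[OF assms] by (auto simp: isos_def hom_def)

lemma tp1_natural:
  assumes "h \<in> Ar C" "k \<in> Ar C"
  shows "tp1 S (Cod C h) (Cod C k) \<cdot> (sh\<^sub>a S h \<odot> k) = sh\<^sub>a S (h \<odot> k) \<cdot> tp1 S (Dom C h) (Dom C k)"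
  using tp1_nat assms by (auto simp: hom_def)

lemma tp2_natural:
  assumes "h \<in> Ar C" "k \<in> Ar C"
  shows "tp2 S (Cod C h) (Cod C k) \<cdot> (h \<odot> sh\<^sub>a S k) = sh\<^sub>a S (h \<odot> k) \<cdot> tp2 S (Dom C h) (Dom C k)"
  using tp2_nat assms by (auto simp: hom_def)

text \<open>Since \<open>tp1\<close> is invertible, an arrow to \<open>T[Y, K]\<close> is also determined by an evaluation.\<close>

lemma shift_hom_eqI:
  assumes uv [simp]: "u \<in> Ar C" "v \<in> Ar C" "Dom C u = Z" "Dom C v = Z"
      "Cod C u = sh\<^sub>o S (hob C Y K)" "Cod C v = sh\<^sub>o S (hob C Y K)" "Y \<in> Ob C" "K \<in> Ob C"
    and eq: "sh\<^sub>a S (evl C Y K) \<cdot> (tp1 S (hob C Y K) Y \<cdot> (u \<odot> Idt C Y)) =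
      sh\<^sub>a S (evl C Y K) \<cdot> (tp1 S (hob C Y K) Y \<cdot> (v \<odot> Idt C Y))"
  shows "u = v"
proof -
  have Z [simp]: "Z \<in> Ob C" using uv(1,3) Dom_Ob by blast
  \<comment> \<open>Writing \<open>w\<close> as the shift of \<open>ush\<^sub>a S w\<close> lets
    \<open>tp1\<close> pass it: the test becomes one shifted arrow after an invertible
    \<open>tp1\<close>, and T\<inverse> can be applied once \<open>tp1\<close> is cancelled.\<close>
  have *: "sh\<^sub>a S (evl C Y K) \<cdot> (tp1 S (hob C Y K) Y \<cdot> (w \<odot> Idt C Y)) =
      sh\<^sub>a S (evl C Y K \<cdot> (ush\<^sub>a S w \<odot> Idt C Y)) \<cdot> tp1 S (ush\<^sub>o S Z) Y"
    if [simp]: "w \<in> Ar C" "Dom C w = Z" "Cod C w = sh\<^sub>o S (hob C Y K)" for w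
    using tp1_natural[of "ush\<^sub>a S w" "Idt C Y"] by simp
  have "sh\<^sub>a S (evl C Y K \<cdot> (ush\<^sub>a S u \<odot> Idt C Y)) = sh\<^sub>a S (evl C Y K \<cdot> (ush\<^sub>a S v \<odot> Idt C Y))"
    using eq unfolding *[OF uv(1,3,5)] *[OF uv(2,4,6)]
    by (rule iso_cancel_right[OF tp1_iso[of "ush\<^sub>o S Z" Y], rotated 2]) simp_all
  then have "ush\<^sub>a S (sh\<^sub>a S (evl C Y K \<cdot> (ush\<^sub>a S u \<odot> Idt C Y))) = ush\<^sub>a S (sh\<^sub>a S (evl C Y K \<cdot> (ush\<^sub>a S v \<odot> Idt C Y)))"
    by (simp only:)
  then have "evl C Y K \<cdot> (ush\<^sub>a S u \<odot> Idt C Y) = evl C Y K \<cdot> (ush\<^sub>a S v \<odot> Idt C Y)"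
    by (subst (asm) (1 2) ush_sh_ar) simp_all
  then have "ush\<^sub>a S u = ush\<^sub>a S v"
    by (rule hom_eqI[of _ _ Y K, rotated 7]) simp_all
  then have "sh\<^sub>a S (ush\<^sub>a S u) = sh\<^sub>a S (ush\<^sub>a S v)" by (simp only:)
  then show ?thesis by simp
qed

text \<open>The last equation is the definition of \<open>hom_dual_comm\<close> shifted by \<open>T\<close> and composed with \<open>tp1\<close>,
  so that neither \<open>T\<inverse>\<close> nor the inverse of \<open>tp1\<close> acts on an arrow.\<close>

lemma hom_dual_comm_eq:
  assumes [simp]: "A \<in> Ob C" "K \<in> Ob C"
  shows "hom_dual_comm C S K A \<in> Ar C"
    and "Dom C (hom_dual_comm C S K A) = ush\<^sub>o S (hob C A K)"
    and "Cod C (hom_dual_comm C S K A) = hob C (sh\<^sub>o S A) K"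
    and "sh\<^sub>a S (evl C (sh\<^sub>o S A) K) \<cdot> (tp1 S (hob C (sh\<^sub>o S A) K) (sh\<^sub>o S A) \<cdot>
        (sh\<^sub>a S (hom_dual_comm C S K A) \<odot> Idt C (sh\<^sub>o S A))) =
      sh\<^sub>a S (evl C A K) \<cdot> tp2 S (hob C A K) A"
proof -
  let ?H = "hob C A K" and ?TA = "sh\<^sub>o S A"
  let ?m = "hom_dual_comm C S K A" and ?t = "arr_inv C (tp1 S (ush\<^sub>o S ?H) ?TA)"
  have "tp1 S (ush\<^sub>o S ?H) ?TA \<in> isos C (?H \<otimes> ?TA) (sh\<^sub>o S (ush\<^sub>o S ?H \<otimes> ?TA))"
    using tp1_iso[of "ush\<^sub>o S ?H" ?TA] by simp
  note t [simp] = arr_inv_arrow[OF this]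
  let ?e = "evl C A K \<cdot> (ush\<^sub>a S (tp2 S ?H A) \<cdot> ush\<^sub>a S ?t)"
  have m: "?m = hom_transpose C (ush\<^sub>o S ?H) ?TA ?e"
    by (simp add: hom_dual_comm_def Let_def)
  show m' [simp]: "?m \<in> Ar C" "Dom C ?m = ush\<^sub>o S ?H" "Cod C ?m = hob C ?TA K"
    by (simp_all add: m)
  have "sh\<^sub>a S (evl C ?TA K) \<cdot> (tp1 S (hob C ?TA K) ?TA \<cdot> (sh\<^sub>a S ?m \<odot> Idt C ?TA)) =
      sh\<^sub>a S (evl C ?TA K \<cdot> (?m \<odot> Idt C ?TA)) \<cdot> tp1 S (ush\<^sub>o S ?H) ?TA"
    using tp1_natural[of ?m "Idt C ?TA"] by simp
  also have "evl C ?TA K \<cdot> (?m \<odot> Idt C ?TA) = ?e"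
    using evl_hom_transpose[of "ush\<^sub>o S ?H" ?TA ?e] by (simp add: m)
  also have "sh\<^sub>a S ?e \<cdot> tp1 S (ush\<^sub>o S ?H) ?TA = sh\<^sub>a S (evl C A K) \<cdot> tp2 S ?H A"
    by simp
  finally show "sh\<^sub>a S (evl C ?TA K) \<cdot> (tp1 S (hob C ?TA K) ?TA \<cdot> (sh\<^sub>a S ?m \<odot> Idt C ?TA)) =
      sh\<^sub>a S (evl C A K) \<cdot> tp2 S ?H A" .
qed

lemmas hom_dual_comm_arrow [simp] = hom_dual_comm_eq(1-3)

text \<open>The characterization of the commutation arrow at T\<inverse>A, the object at which the
  suspended condition evaluates it, with room for \<open>u\<close> and \<open>x\<close>. From left
  to right it replaces \<open>tp1\<close> at \<open>A\<close> by \<open>tp2\<close> at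
  T\<inverse>A.\<close>

lemma evl_hom_dual_comm:
  assumes [simp]: "A \<in> Ob C" "K \<in> Ob C" "u \<in> Ar C" "x \<in> Ar C"
    "Cod C u = hob C (ush\<^sub>o S A) K" "Cod C x = A"
  shows "sh\<^sub>a S (evl C A K) \<cdot> (tp1 S (hob C A K) A \<cdot>
      ((sh\<^sub>a S (hom_dual_comm C S K (ush\<^sub>o S A)) \<cdot> u) \<odot> x)) =
    sh\<^sub>a S (evl C (ush\<^sub>o S A) K) \<cdot> (tp2 S (hob C (ush\<^sub>o S A) K) (ush\<^sub>o S A) \<cdot> (u \<odot> x))"
proof -
  have "(sh\<^sub>a S (evl C A K) \<cdot> (tp1 S (hob C A K) A \<cdot>
      (sh\<^sub>a S (hom_dual_comm C S K (ush\<^sub>o S A)) \<odot> Idt C A))) \<cdot> (u \<odot> x) =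
      (sh\<^sub>a S (evl C (ush\<^sub>o S A) K) \<cdot> tp2 S (hob C (ush\<^sub>o S A) K) (ush\<^sub>o S A)) \<cdot> (u \<odot> x)"
    using hom_dual_comm_eq(4)[of "ush\<^sub>o S A" K] by simp
  then show ?thesis by (simp add: tar_Cmp)
qed

lemma hom_sduality_is_sduality: "K \<in> Ob C \<Longrightarrow> is_sduality C S (hom_sduality C S K)"
  using hom_duality_is_duality[of K "hom_sduality C S K"]
  by (simp add: is_sduality_def hom_sduality_def mem_hom_iff) (simp add: hom_dual_def)

text \<open>\<iota> acts only on the values of the evaluation. It leaves the Hom at T\<inverse>A by
  naturality, the characterization of the commutation arrow for \<open>K\<close> is applied behind
  it, and it enters the Hom again at \<open>A\<close>.\<close>

lemma change_suspended_dp_functor: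
  assumes \<iota> [simp]: "\<iota> \<in> Ar C" and K: "Dom C \<iota> = K" "Cod C \<iota> = M"
  shows "suspended_dp_functor C S (hom_sduality C S K) C S (hom_sduality C S M) (change_sdpf C S \<iota>)"
proof -
  have [simp]: "K \<in> Ob C" "M \<in> Ob C" using K \<iota> by auto
  let ?\<Phi> = "change_sdpf C S \<iota>"
  have \<Phi>: "dfun ?\<Phi> = id_functor" "dnat ?\<Phi> = (\<lambda>A. har C (Idt C A) \<iota>)" "dcomm ?\<Phi> = (\<lambda>A. Idt C (sh\<^sub>o S A))"
    by (simp_all add: change_sdpf_def change_dpf_def dpf.defs)
  have dp: "dp_functor C (hom_sduality C S K) C (hom_sduality C S M) ?\<Phi>"
    by (rule change_dp_functor[OF \<iota> K]) (simp_all add: hom_sduality_def \<Phi>)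
  have "sh\<^sub>a S (hom_dual_comm C S M (ush\<^sub>o S A)) \<cdot> har C (Idt C (ush\<^sub>o S A)) \<iota> =
      sh\<^sub>a S (har C (Idt C A) \<iota>) \<cdot> sh\<^sub>a S (hom_dual_comm C S K (ush\<^sub>o S A))" if [simp]: "A \<in> Ob C" for A
  proof (rule shift_hom_eqI[of _ _ "hob C (ush\<^sub>o S A) K" A M])
    let ?B = "ush\<^sub>o S A"
    let ?n = "\<lambda>K. sh\<^sub>a S (hom_dual_comm C S K ?B)"
    have "sh\<^sub>a S (evl C A M) \<cdot> (tp1 S (hob C A M) A \<cdot> ((?n M \<cdot> har C (Idt C ?B) \<iota>) \<odot> Idt C A)) =
      sh\<^sub>a S (evl C ?B M \<cdot> (har C (Idt C ?B) \<iota> \<odot> Idt C ?B)) \<cdot> tp2 S (hob C ?B K) ?B"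
      using tp2_natural[of "har C (Idt C ?B) \<iota>" "Idt C ?B"] K by (simp add: evl_hom_dual_comm)
    also have "\<dots> = sh\<^sub>a S (\<iota> \<cdot> evl C ?B K) \<cdot> tp2 S (hob C ?B K) ?B"
      using evl_natural[of ?B \<iota>] K by simp
    also have "\<dots> = sh\<^sub>a S \<iota> \<cdot> (sh\<^sub>a S (evl C A K) \<cdot> (tp1 S (hob C A K) A \<cdot> (?n K \<odot> Idt C A)))"
      using evl_hom_dual_comm[of A K "Idt C (hob C ?B K)" "Idt C A"] K by simp
    also have "\<dots> = sh\<^sub>a S (evl C A M \<cdot> (har C (Idt C A) \<iota> \<odot> Idt C A)) \<cdot> (tp1 S (hob C A K) A \<cdot> (?n K \<odot> Idt C A))"
      using evl_natural[of A \<iota>] K by simp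
    also have "\<dots> = sh\<^sub>a S (evl C A M) \<cdot> (tp1 S (hob C A M) A \<cdot> ((sh\<^sub>a S (har C (Idt C A) \<iota>) \<cdot> ?n K) \<odot> Idt C A))"
      using Cmp_rewrite[OF tp1_natural[of "har C (Idt C A) \<iota>" "Idt C A"], of "?n K \<odot> Idt C A"] K
      by (simp add: tar_Cmp)
    finally show "sh\<^sub>a S (evl C A M) \<cdot> (tp1 S (hob C A M) A \<cdot> ((?n M \<cdot> har C (Idt C ?B) \<iota>) \<odot> Idt C A)) =
      sh\<^sub>a S (evl C A M) \<cdot> (tp1 S (hob C A M) A \<cdot> ((sh\<^sub>a S (har C (Idt C A) \<iota>) \<cdot> ?n K) \<odot> Idt C A))" .
  qed (use K in simp_all)
  then show ?thesis
    using dp suspended_functor_id[OF suspended_category_axioms] K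
    by (simp add: suspended_dp_functor_iff \<Phi>) (simp add: hom_sduality_def hom_dual_def)
qed

end

locale suspended_closed_monoidal_functor =
  source: suspended_smcc C S + target: suspended_smcc D R + closed_monoidal_functor C D F \<alpha> \<epsilon>
  for C :: "('o, 'm, 'y) smcc_scheme" and S :: "('o, 'm, 'w) tsusp_scheme"
    and D :: "('p, 'n, 'z) smcc_scheme" and R :: "('p, 'n, 'x) tsusp_scheme"
    and F :: "('o, 'm, 'p, 'n) cfunctor" and \<alpha> :: "'o \<Rightarrow> 'o \<Rightarrow> 'n" and \<epsilon> :: 'n +
  fixes \<theta> :: "'o \<Rightarrow> 'n"
  assumes suspended_monoidal: "suspended_monoidal_functor C S D R F \<theta> \<alpha> \<epsilon>"
begin

lemma suspended: "suspended_functor C S D R F \<theta>"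
  using suspended_monoidal by (simp add: suspended_monoidal_functor_def)

lemmas comm_arrow [simp] = nat_trans_arrow[OF suspended_functorD(4)[OF suspended], simplified]

lemmas comm_natural = nat_trans_natural[OF suspended_functorD(4)[OF suspended], simplified]

lemma mult_tp:
  assumes "A \<in> Ob C" "B \<in> Ob C"
  shows "\<theta> (A \<otimes>\<^bsub>C\<^esub> B) \<cdot>\<^bsub>D\<^esub> (far F (tp1 S A B) \<cdot>\<^bsub>D\<^esub> \<alpha> (sh\<^sub>o S A) B) =
      sh\<^sub>a R (\<alpha> A B) \<cdot>\<^bsub>D\<^esub> (tp1 R (fob F A) (fob F B) \<cdot>\<^bsub>D\<^esub> (\<theta> A \<odot>\<^bsub>D\<^esub> Idt D (fob F B)))"
    and "\<theta> (A \<otimes>\<^bsub>C\<^esub> B) \<cdot>\<^bsub>D\<^esub> (far F (tp2 S A B) \<cdot>\<^bsub>D\<^esub> \<alpha> A (sh\<^sub>o S B)) =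
      sh\<^sub>a R (\<alpha> A B) \<cdot>\<^bsub>D\<^esub> (tp2 R (fob F A) (fob F B) \<cdot>\<^bsub>D\<^esub> (Idt D (fob F A) \<odot>\<^bsub>D\<^esub> \<theta> B))"
  using suspended_monoidal assms by (simp_all add: suspended_monoidal_functor_def)

text \<open>The shifted evaluation of the left side leads to \<open>tp2\<close> in \<open>D\<close>.
  Compatibility of \<open>F\<close> with \<open>tp2\<close> carries it to \<open>C\<close>, where
  the arrow \<open>n\<close> exchanges it for \<open>tp1\<close>, and compatibility with
  \<open>tp1\<close> leads back to \<open>D\<close> and to the right side.\<close>

lemma beta_suspended:
  assumes [simp]: "A \<in> Ob C" "K \<in> Ob C"
  defines "n' \<equiv> sh\<^sub>a R (hom_dual_comm D R (fob F K) (ush\<^sub>o R (fob F A)))"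
    and "n \<equiv> sh\<^sub>a S (hom_dual_comm C S K (ush\<^sub>o S A))"
    and "b \<equiv> beta C D F \<alpha> K"
  shows "n' \<cdot>\<^bsub>D\<^esub> (har D (ush\<^sub>a R (\<theta> (ush\<^sub>o S A))) (Idt D (fob F K)) \<cdot>\<^bsub>D\<^esub> b (ush\<^sub>o S A)) =
    sh\<^sub>a R (b A) \<cdot>\<^bsub>D\<^esub> (\<theta> (hob C A K) \<cdot>\<^bsub>D\<^esub> far F n)" (is "?u = ?v")
proof (rule target.shift_hom_eqI[of _ _ "fob F (hob C (ush\<^sub>o S A) K)" "fob F A" "fob F K"])
  let ?B = "ush\<^sub>o S A" and ?FA = "fob F A" and ?FK = "fob F K"
  let ?t = "ush\<^sub>a R (\<theta> ?B)" and ?H = "hob C ?B K" and ?H' = "hob C A K"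
  let ?C = "ush\<^sub>o R ?FA" and ?e = "evl D ?FA ?FK"
  let ?w = "har D ?t (Idt D ?FK) \<cdot>\<^bsub>D\<^esub> b ?B"
  have n' [simp]: "n' \<in> Ar D" "Dom D n' = hob D ?C ?FK" "Cod D n' = sh\<^sub>o R (hob D ?FA ?FK)"
    by (simp_all add: n'_def)
  have n [simp]: "n \<in> Ar C" "Dom C n = ?H" "Cod C n = sh\<^sub>o S ?H'"
    by (simp_all add: n_def)
  have b [simp]: "b X \<in> Ar D" "Dom D (b X) = fob F (hob C X K)" "Cod D (b X) = hob D (fob F X) ?FK"
    if "X \<in> Ob C" for X
    using that by (simp_all add: b_def)
  have evl_b: "evl D (fob F X) ?FK \<cdot>\<^bsub>D\<^esub> (b X \<odot>\<^bsub>D\<^esub> x) = far F (evl C X K) \<cdot>\<^bsub>D\<^esub> (\<alpha> (hob C X K) X \<cdot>\<^bsub>D\<^esub> (Idt D (fob F (hob C X K)) \<odot>\<^bsub>D\<^esub> x))"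
    if "X \<in> Ob C" "x \<in> Ar D" "Cod D x = fob F X" for X x
    using that evl_beta[of X K "Idt D (fob F (hob C X K))" x] by (simp add: b_def)
  have "sh\<^sub>a R ?e \<cdot>\<^bsub>D\<^esub> (tp1 R (hob D ?FA ?FK) ?FA \<cdot>\<^bsub>D\<^esub> (?u \<odot>\<^bsub>D\<^esub> Idt D ?FA)) =
      sh\<^sub>a R (evl D ?C ?FK \<cdot>\<^bsub>D\<^esub> (?w \<odot>\<^bsub>D\<^esub> Idt D ?C)) \<cdot>\<^bsub>D\<^esub> tp2 R (fob F ?H) ?C"
    using target.tp2_natural[of ?w "Idt D ?C"] by (simp add: n'_def target.evl_hom_dual_comm)
  \<comment> \<open>Dinaturality takes \<open>?t\<close>, which is T\<inverse>\<theta>, out of the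
    Hom. The next step shifts it back to \<theta> while passing \<open>tp2\<close>, the form in
    which the compatibility of \<alpha> with \<open>tp2\<close> is stated.\<close>
  also have "evl D ?C ?FK \<cdot>\<^bsub>D\<^esub> (?w \<odot>\<^bsub>D\<^esub> Idt D ?C) =
      far F (evl C ?B K) \<cdot>\<^bsub>D\<^esub> (\<alpha> ?H ?B \<cdot>\<^bsub>D\<^esub> (Idt D (fob F ?H) \<odot>\<^bsub>D\<^esub> ?t))"
    using target.evl_har_right[of ?t ?FK "b ?B" "Idt D ?C"] by (simp add: evl_b)
  also have "sh\<^sub>a R \<dots> \<cdot>\<^bsub>D\<^esub> tp2 R (fob F ?H) ?C =
      sh\<^sub>a R (far F (evl C ?B K)) \<cdot>\<^bsub>D\<^esub> (sh\<^sub>a R (\<alpha> ?H ?B) \<cdot>\<^bsub>D\<^esub>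
        (tp2 R (fob F ?H) (fob F ?B) \<cdot>\<^bsub>D\<^esub> (Idt D (fob F ?H) \<odot>\<^bsub>D\<^esub> \<theta> ?B)))"
    using target.tp2_natural[of "Idt D (fob F ?H)" ?t] by simp
  also have "\<dots> = sh\<^sub>a R (far F (evl C ?B K)) \<cdot>\<^bsub>D\<^esub> (\<theta> (?H \<otimes>\<^bsub>C\<^esub> ?B) \<cdot>\<^bsub>D\<^esub> (far F (tp2 S ?H ?B) \<cdot>\<^bsub>D\<^esub> \<alpha> ?H A))"
    using mult_tp(2)[of ?H ?B] by simp
  also have "\<dots> = \<theta> K \<cdot>\<^bsub>D\<^esub> (far F (sh\<^sub>a S (evl C ?B K) \<cdot>\<^bsub>C\<^esub> tp2 S ?H ?B) \<cdot>\<^bsub>D\<^esub> \<alpha> ?H A)"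
    using target.Cmp_rewrite[OF comm_natural[of "evl C ?B K"], of "far F (tp2 S ?H ?B) \<cdot>\<^bsub>D\<^esub> \<alpha> ?H A"] by simp
  \<comment> \<open>The exchange of \<open>tp2\<close> for \<open>tp1\<close> in the source
    category, read against its use in the target, where the first equation replaced
    \<open>tp1\<close> by \<open>tp2\<close>.\<close>
  also have "sh\<^sub>a S (evl C ?B K) \<cdot>\<^bsub>C\<^esub> tp2 S ?H ?B =
      sh\<^sub>a S (evl C A K) \<cdot>\<^bsub>C\<^esub> (tp1 S ?H' A \<cdot>\<^bsub>C\<^esub> (n \<odot>\<^bsub>C\<^esub> Idt C A))"
    using source.evl_hom_dual_comm[of A K "Idt C ?H" "Idt C A"] by (simp add: n_def)
  also have "\<theta> K \<cdot>\<^bsub>D\<^esub> (far F \<dots> \<cdot>\<^bsub>D\<^esub> \<alpha> ?H A) =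
      \<theta> K \<cdot>\<^bsub>D\<^esub> (far F (sh\<^sub>a S (evl C A K)) \<cdot>\<^bsub>D\<^esub> (far F (tp1 S ?H' A) \<cdot>\<^bsub>D\<^esub>
        (\<alpha> (sh\<^sub>o S ?H') A \<cdot>\<^bsub>D\<^esub> (far F n \<odot>\<^bsub>D\<^esub> Idt D ?FA))))"
    using mult_natural[of n "Idt C A"] by simp
  also have "\<dots> = sh\<^sub>a R (far F (evl C A K)) \<cdot>\<^bsub>D\<^esub> ((\<theta> (?H' \<otimes>\<^bsub>C\<^esub> A) \<cdot>\<^bsub>D\<^esub> (far F (tp1 S ?H' A) \<cdot>\<^bsub>D\<^esub>
        \<alpha> (sh\<^sub>o S ?H') A)) \<cdot>\<^bsub>D\<^esub> (far F n \<odot>\<^bsub>D\<^esub> Idt D ?FA))"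
    using target.Cmp_rewrite[OF comm_natural[of "evl C A K"],
        of "far F (tp1 S ?H' A) \<cdot>\<^bsub>D\<^esub> (\<alpha> (sh\<^sub>o S ?H') A \<cdot>\<^bsub>D\<^esub> (far F n \<odot>\<^bsub>D\<^esub> Idt D ?FA))"] by simp
  also have "\<dots> = sh\<^sub>a R (far F (evl C A K) \<cdot>\<^bsub>D\<^esub> \<alpha> ?H' A) \<cdot>\<^bsub>D\<^esub> (tp1 R (fob F ?H') ?FA \<cdot>\<^bsub>D\<^esub>
        ((\<theta> ?H' \<cdot>\<^bsub>D\<^esub> far F n) \<odot>\<^bsub>D\<^esub> Idt D ?FA))"
    by (simp add: mult_tp(1) target.tar_Cmp)
  also have "far F (evl C A K) \<cdot>\<^bsub>D\<^esub> \<alpha> ?H' A = ?e \<cdot>\<^bsub>D\<^esub> (b A \<odot>\<^bsub>D\<^esub> Idt D ?FA)"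
    by (simp add: evl_b)
  also have "sh\<^sub>a R \<dots> \<cdot>\<^bsub>D\<^esub> (tp1 R (fob F ?H') ?FA \<cdot>\<^bsub>D\<^esub> ((\<theta> ?H' \<cdot>\<^bsub>D\<^esub> far F n) \<odot>\<^bsub>D\<^esub> Idt D ?FA)) =
      sh\<^sub>a R ?e \<cdot>\<^bsub>D\<^esub> (tp1 R (hob D ?FA ?FK) ?FA \<cdot>\<^bsub>D\<^esub> (?v \<odot>\<^bsub>D\<^esub> Idt D ?FA))"
    using target.Cmp_rewrite[OF target.tp1_natural[of "b A" "Idt D ?FA"],
        of "(\<theta> ?H' \<cdot>\<^bsub>D\<^esub> far F n) \<odot>\<^bsub>D\<^esub> Idt D ?FA"]
    by (simp add: target.tar_Cmp)
  finally show "sh\<^sub>a R ?e \<cdot>\<^bsub>D\<^esub> (tp1 R (hob D ?FA ?FK) ?FA \<cdot>\<^bsub>D\<^esub> (?u \<odot>\<^bsub>D\<^esub> Idt D ?FA)) =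
    sh\<^sub>a R ?e \<cdot>\<^bsub>D\<^esub> (tp1 R (hob D ?FA ?FK) ?FA \<cdot>\<^bsub>D\<^esub> (?v \<odot>\<^bsub>D\<^esub> Idt D ?FA))" .
qed (simp_all add: n'_def n_def b_def)

lemma pull_suspended_dp_functor:
  assumes K [simp]: "K \<in> Ob C"
    and \<Phi>: "dfun \<Phi> = F" "dnat \<Phi> = beta C D F \<alpha> K" "dcomm \<Phi> = \<theta>"
  shows "suspended_dp_functor C S (hom_sduality C S K) D R (hom_sduality D R (fob F K)) \<Phi>"
proof -
  have "dp_functor C (hom_sduality C S K) D (hom_sduality D R (fob F K)) \<Phi>"
    by (rule pull_dp_functor[OF K]) (simp_all add: hom_sduality_def \<Phi>)
  then show ?thesis
    using suspended beta_suspended[of _ K]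
    by (simp add: suspended_dp_functor_iff \<Phi>) (simp add: hom_sduality_def hom_dual_def)
qed

end

section \<open>Exact functors\<close>

text \<open>The premise on \<open>\<Delta>\<close> supplies the types of the arrows of a triangle,
  so that \<open>G\<close> preserves the composite of \<theta> with the image of the connecting
  arrow \<open>w\<close>.\<close>

lemma exact_functor_cmp:
  assumes F: "exact_functor C S \<Delta> D R \<Gamma> F \<theta>" and G: "exact_functor D R \<Gamma> E Q \<Lambda> G \<kappa>"
    and \<Delta>: "\<Delta> \<subseteq> triangles C S"
  shows "exact_functor C S \<Delta> E Q \<Lambda> (G \<circ>\<^sub>F F) (cmp_comm E G \<kappa> F \<theta>)"
proof -
  have sf: "suspended_functor C S D R F \<theta>" "suspended_functor D R E Q G \<kappa>"
    using F G by (simp_all add: exact_functor_def)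
  interpret F: cat_functor C D F by unfold_locales (rule suspended_functorD(3)[OF sf(1)])
  interpret G: cat_functor D E G by unfold_locales (rule suspended_functorD(3)[OF sf(2)])
  interpret suspended_category C S by (rule suspended_functorD(1)[OF sf(1)])
  interpret R: suspended_category D R by (rule suspended_functorD(1)[OF sf(2)])
  note [simp] = nat_trans_arrow[OF suspended_functorD(4)[OF sf(1)], simplified]
    nat_trans_arrow[OF suspended_functorD(4)[OF sf(2)], simplified]
  have "(far G (far F u), far G (far F v), cmp_comm E G \<kappa> F \<theta> (Dom C u) \<cdot>\<^bsub>E\<^esub> far G (far F w)) \<in> \<Lambda>"
    if uvw: "(u, v, w) \<in> \<Delta>" for u v w
  proof -
    have [simp]: "u \<in> Ar C" "w \<in> Ar C" "Cod C w = sh\<^sub>o S (Dom C u)"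
      using uvw \<Delta> by (auto simp: triangles_def hom_def)
    have "(far F u, far F v, \<theta> (Dom C u) \<cdot>\<^bsub>D\<^esub> far F w) \<in> \<Gamma>"
      using F uvw by (auto simp: exact_functor_def)
    then have "(far G (far F u), far G (far F v),
        \<kappa> (Dom D (far F u)) \<cdot>\<^bsub>E\<^esub> far G (\<theta> (Dom C u) \<cdot>\<^bsub>D\<^esub> far F w)) \<in> \<Lambda>"
      using G by (auto simp: exact_functor_def)
    then show ?thesis by (simp add: cmp_comm_def)
  qed
  then show ?thesis
    using suspended_functor_cmp[OF sf] by (auto simp: exact_functor_def)
qed

lemma exact_functor_id:
  assumes "triangulated_category C S \<Delta>"
  shows "exact_functor C S \<Delta> C S \<Delta> id_functor (\<lambda>A. Idt C (sh\<^sub>o S A))"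
proof -
  interpret triangulated_category C S \<Delta> by fact
  have "Idt C (sh\<^sub>o S (Dom C u)) \<cdot>\<^bsub>C\<^esub> w = w" if "(u, v, w) \<in> \<Delta>" for u v w
    using that exact_triangles by (auto simp: triangles_def hom_def)
  then show ?thesis
    using suspended_functor_id[OF suspended_category_axioms] by (auto simp: exact_functor_def)
qed

section \<open>Pseudo functors\<close>

lemma id_functor_cmp [simp]: "id_functor \<circ>\<^sub>F F = F"
  by (simp add: cmp_functor_def id_functor_def)

lemma dp_comp_simps [simp]:
  "dfun (dp_comp D \<Psi> \<Phi>) = dfun \<Psi> \<circ>\<^sub>F dfun \<Phi>"
  "dnat (dp_comp D \<Psi> \<Phi>) A = dnat \<Psi> (fob (dfun \<Phi>) A) \<cdot>\<^bsub>D\<^esub> far (dfun \<Psi>) (dnat \<Phi> A)"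
  by (simp_all add: dp_comp_def)

lemma change_dpf_simps [simp]:
  "dfun (change_dpf C \<iota>) = id_functor" "dnat (change_dpf C \<iota>) = (\<lambda>A. har C (Idt C A) \<iota>)"
  "dfun (change_sdpf C S \<iota>) = id_functor" "dnat (change_sdpf C S \<iota>) = (\<lambda>A. har C (Idt C A) \<iota>)"
  "dcomm (change_sdpf C S \<iota>) = (\<lambda>A. Idt C (sh\<^sub>o S A))"
  by (simp_all add: change_dpf_def change_sdpf_def dpf.defs)

lemma pull_dpf_simps [simp]:
  "dfun (pull_dpf B P f K) = pull P f"
  "dnat (pull_dpf B P f K) = beta (fib P (Cod B f)) (fib P (Dom B f)) (pull P f) (mcomp P f) K"
  "dfun (pull_sdpf B Q f K) = pull Q f"
  "dnat (pull_sdpf B Q f K) = beta (fib Q (Cod B f)) (fib Q (Dom B f)) (pull Q f) (mcomp Q f) K"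
  "dcomm (pull_sdpf B Q f K) = pcomm Q f"
  by (simp_all add: pull_dpf_def pull_sdpf_def dpf.defs)

lemma hom_duality_simps [simp]:
  "dual (hom_duality C K) = hom_dual C K" "bidual (hom_duality C K) = hom_bidual C K"
  "dual (hom_sduality C S K) = hom_dual C K" "bidual (hom_sduality C S K) = hom_bidual C K"
  by (simp_all add: hom_duality_def hom_sduality_def)

section \<open>The structure isomorphism of the pseudo functor and \<beta>\<close>

context monoidal_pseudo_functor
begin

lemma pull_closed_monoidal:
  assumes f: "f \<in> hom B X Y"
  shows "closed_monoidal_functor (fib P Y) (fib P X) (pull P f) (mcomp P f) (ucomp P f)"
proof -
  have "X \<in> Ob B" "Y \<in> Ob B" using f by (auto simp: hom_def)
  then interpret X: symmetric_monoidal_closed_category "fib P X" +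
    Y: symmetric_monoidal_closed_category "fib P Y"
    by (simp_all add: fib_smcc)
  show ?thesis by unfold_locales (rule pull_monoidal[OF f])
qed

lemma acomp_nat_trans:
  assumes "f \<in> hom B X Y" "g \<in> hom B Y Z"
  shows "nat_trans (fib P Z) (fib P X) (pull P f \<circ>\<^sub>F pull P g) (pull P (g \<cdot> f)) (acomp P g f)"
  using acomp_iso[OF assms] by (simp add: nat_iso_def)

text \<open>Evaluation peels the left side from the outside: \<open>a K\<close> leaves the Hom, then
  each \<beta> becomes the image of an evaluation. On the right \<open>a A\<close> sits in the
  contravariant variable and moves to the second tensor factor, beside \<open>a\<close> at the
  internal Hom; this produces a \<otimes> a.\<close>

lemma acomp_beta:
  assumes f: "f \<in> hom B X Y" and g: "g \<in> hom B Y Z" and K [simp]: "K \<in> Ob (fib P Z)" and A [simp]: "A \<in> Ob (fib P Z)"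
  defines "a \<equiv> acomp P g f" and "\<beta>f \<equiv> beta (fib P Y) (fib P X) (pull P f) (mcomp P f) (fob (pull P g) K)"
    and "\<beta>g \<equiv> beta (fib P Z) (fib P Y) (pull P g) (mcomp P g) K"
    and "\<beta>gf \<equiv> beta (fib P Z) (fib P X) (pull P (g \<cdot> f)) (mcomp P (g \<cdot> f)) K"
  shows "har (fib P X) (Idt (fib P X) (fob (pull P f) (fob (pull P g) A))) (a K) \<cdot>\<^bsub>fib P X\<^esub>
      (\<beta>f (fob (pull P g) A) \<cdot>\<^bsub>fib P X\<^esub> far (pull P f) (\<beta>g A)) =
    har (fib P X) (a A) (Idt (fib P X) (fob (pull P (g \<cdot> f)) K)) \<cdot>\<^bsub>fib P X\<^esub>
      (\<beta>gf A \<cdot>\<^bsub>fib P X\<^esub> a (hob (fib P Z) A K))" (is "?u = ?v")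
proof -
  let ?X = "fib P X" and ?Y = "fib P Y" and ?Z = "fib P Z"
  let ?F = "pull P f" and ?G = "pull P g" and ?GF = "pull P (g \<cdot> f)"
  have gf: "g \<cdot> f \<in> hom B X Z" using cmp_hom[OF f g] .
  interpret F: closed_monoidal_functor ?Y ?X ?F "mcomp P f" "ucomp P f" by (rule pull_closed_monoidal[OF f])
  interpret G: closed_monoidal_functor ?Z ?Y ?G "mcomp P g" "ucomp P g" by (rule pull_closed_monoidal[OF g])
  interpret GF: closed_monoidal_functor ?Z ?X ?GF "mcomp P (g \<cdot> f)" "ucomp P (g \<cdot> f)"
    by (rule pull_closed_monoidal[OF gf])
  note a [simp] = nat_trans_arrow[OF acomp_nat_trans[OF f g], folded a_def, simplified]
  note an = nat_trans_natural[OF acomp_nat_trans[OF f g], folded a_def, simplified]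
  have b [simp]: "\<beta>f (fob ?G A) \<in> Ar ?X" "Dom ?X (\<beta>f (fob ?G A)) = fob ?F (hob ?Y (fob ?G A) (fob ?G K))"
    "Cod ?X (\<beta>f (fob ?G A)) = hob ?X (fob ?F (fob ?G A)) (fob ?F (fob ?G K))"
    "\<beta>g A \<in> Ar ?Y" "Dom ?Y (\<beta>g A) = fob ?G (hob ?Z A K)" "Cod ?Y (\<beta>g A) = hob ?Y (fob ?G A) (fob ?G K)"
    "\<beta>gf A \<in> Ar ?X" "Dom ?X (\<beta>gf A) = fob ?GF (hob ?Z A K)" "Cod ?X (\<beta>gf A) = hob ?X (fob ?GF A) (fob ?GF K)"
    by (simp_all add: \<beta>f_def \<beta>g_def \<beta>gf_def)
  let ?H = "hob ?Z A K" and ?A = "fob ?F (fob ?G A)" and ?GA = "fob ?G A" and ?GK = "fob ?G K"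
  let ?e = "evl ?X ?A (fob ?GF K)" and ?i = "Idt ?X ?A"
  show ?thesis
  proof (rule F.target.hom_eqI[of _ _ ?A "fob ?GF K"])
    have "?e \<cdot>\<^bsub>?X\<^esub> (?u \<odot>\<^bsub>?X\<^esub> ?i) =
      a K \<cdot>\<^bsub>?X\<^esub> (far ?F (evl ?Y ?GA ?GK) \<cdot>\<^bsub>?X\<^esub> (mcomp P f (hob ?Y ?GA ?GK) ?GA \<cdot>\<^bsub>?X\<^esub> (far ?F (\<beta>g A) \<odot>\<^bsub>?X\<^esub> ?i)))"
      using F.target.evl_har_left[of ?A "a K" "\<beta>f ?GA \<cdot>\<^bsub>?X\<^esub> far ?F (\<beta>g A)" ?i]
        F.evl_beta[of ?GA ?GK "far ?F (\<beta>g A)" ?i, folded \<beta>f_def]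
      by simp
    also have "\<dots> = a K \<cdot>\<^bsub>?X\<^esub> (far ?F (evl ?Y ?GA ?GK \<cdot>\<^bsub>?Y\<^esub> (\<beta>g A \<odot>\<^bsub>?Y\<^esub> Idt ?Y ?GA)) \<cdot>\<^bsub>?X\<^esub> mcomp P f (fob ?G ?H) ?GA)"
      using F.mult_natural[of "\<beta>g A" "Idt ?Y ?GA"] by simp
    also have "evl ?Y ?GA ?GK \<cdot>\<^bsub>?Y\<^esub> (\<beta>g A \<odot>\<^bsub>?Y\<^esub> Idt ?Y ?GA) = far ?G (evl ?Z A K) \<cdot>\<^bsub>?Y\<^esub> mcomp P g ?H A"
      using G.evl_beta[of A K "Idt ?Y (fob ?G ?H)" "Idt ?Y ?GA", folded \<beta>g_def] by simp
    \<comment> \<open>Naturality of \<open>a\<close> at the evaluation trades the component at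
      \<open>K\<close> for the one at a tensor product, which is where monoidality of the pseudo
      functor applies.\<close>
    also have "a K \<cdot>\<^bsub>?X\<^esub> (far ?F \<dots> \<cdot>\<^bsub>?X\<^esub> mcomp P f (fob ?G ?H) ?GA) =
      far ?GF (evl ?Z A K) \<cdot>\<^bsub>?X\<^esub> (a (?H \<otimes>\<^bsub>?Z\<^esub> A) \<cdot>\<^bsub>?X\<^esub> (far ?F (mcomp P g ?H A) \<cdot>\<^bsub>?X\<^esub> mcomp P f (fob ?G ?H) ?GA))"
      using F.target.Cmp_rewrite[OF an[of "evl ?Z A K"], of "far ?F (mcomp P g ?H A) \<cdot>\<^bsub>?X\<^esub> mcomp P f (fob ?G ?H) ?GA"]
      by simp
    also have "\<dots> = far ?GF (evl ?Z A K) \<cdot>\<^bsub>?X\<^esub> (mcomp P (g \<cdot> f) ?H A \<cdot>\<^bsub>?X\<^esub> (a ?H \<odot>\<^bsub>?X\<^esub> a A))"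
      using acomp_mcomp[OF f g, of ?H A] by (simp add: a_def)
    also have "\<dots> = ?e \<cdot>\<^bsub>?X\<^esub> (?v \<odot>\<^bsub>?X\<^esub> ?i)"
      using F.target.evl_har_right[of "a A" "fob ?GF K" "\<beta>gf A \<cdot>\<^bsub>?X\<^esub> a ?H" ?i]
        GF.evl_beta[of A K "a ?H" "a A", folded \<beta>gf_def]
      by simp
    finally show "?e \<cdot>\<^bsub>?X\<^esub> (?u \<odot>\<^bsub>?X\<^esub> ?i) = ?e \<cdot>\<^bsub>?X\<^esub> (?v \<odot>\<^bsub>?X\<^esub> ?i)" .
  qed simp_all
qed

text \<open>The records enter through their fields, so one statement serves the plain and the
  suspended version; that both ends preserve the dualities is left to the caller.\<close>

lemma acomp_dp_morphism:
  assumes f: "f \<in> hom B X Y" and g: "g \<in> hom B Y Z" and K: "K \<in> Ob (fib P Z)"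
    and E: "dual E = hom_dual (fib P Z) K" "dual E' = hom_dual (fib P X) (fob (pull P (g \<cdot> f)) K)"
    and dp: "dp_functor (fib P Z) E (fib P X) E' \<Phi>" "dp_functor (fib P Z) E (fib P X) E' \<Phi>'"
    and \<Phi>: "dfun \<Phi> = pull P f \<circ>\<^sub>F pull P g"
      "\<And>A. dnat \<Phi> A = har (fib P X) (Idt (fib P X) (fob (pull P f) (fob (pull P g) A))) (acomp P g f K) \<cdot>\<^bsub>fib P X\<^esub>
        (beta (fib P Y) (fib P X) (pull P f) (mcomp P f) (fob (pull P g) K) (fob (pull P g) A) \<cdot>\<^bsub>fib P X\<^esub>
          far (pull P f) (beta (fib P Z) (fib P Y) (pull P g) (mcomp P g) K A))"
    and \<Phi>': "dfun \<Phi>' = pull P (g \<cdot> f)"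
      "dnat \<Phi>' = beta (fib P Z) (fib P X) (pull P (g \<cdot> f)) (mcomp P (g \<cdot> f)) K"
  shows "dp_morphism (fib P Z) E (fib P X) E' \<Phi> \<Phi>' (acomp P g f)"
  using acomp_beta[OF f g K] acomp_nat_trans[OF f g] dp
  by (simp add: dp_morphism_def \<Phi> \<Phi>' E hom_dual_def)

theorem pull_dp_morphism:
  assumes f: "f \<in> hom B X Y" and g: "g \<in> hom B Y Z" and K: "K \<in> Ob (fib P Z)"
  shows "dp_morphism (fib P Z) (hom_duality (fib P Z) K)
    (fib P X) (hom_duality (fib P X) (fob (pull P (g \<cdot> f)) K))
    (dp_comp (fib P X) (change_dpf (fib P X) (acomp P g f K))
      (dp_comp (fib P X) (pull_dpf B P f (fob (pull P g) K)) (pull_dpf B P g K)))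
    (pull_dpf B P (g \<cdot> f) K) (acomp P g f)"
proof -
  let ?X = "fib P X" and ?Y = "fib P Y" and ?Z = "fib P Z"
  have gf: "g \<cdot> f \<in> hom B X Z" using cmp_hom[OF f g] .
  have [simp]: "Dom B f = X" "Cod B f = Y" "Dom B g = Y" "Cod B g = Z" "Dom B (g \<cdot> f) = X" "Cod B (g \<cdot> f) = Z"
    using f g gf by (auto simp: hom_def)
  interpret F: closed_monoidal_functor ?Y ?X "pull P f" "mcomp P f" "ucomp P f" by (rule pull_closed_monoidal[OF f])
  interpret G: closed_monoidal_functor ?Z ?Y "pull P g" "mcomp P g" "ucomp P g" by (rule pull_closed_monoidal[OF g])
  interpret GF: closed_monoidal_functor ?Z ?X "pull P (g \<cdot> f)" "mcomp P (g \<cdot> f)" "ucomp P (g \<cdot> f)"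
    by (rule pull_closed_monoidal[OF gf])
  note a = nat_trans_arrow[OF acomp_nat_trans[OF f g] K, simplified]
  note is_duality = symmetric_monoidal_closed_category.hom_duality_is_duality[OF _ _ hom_duality_simps(1,2)]
  note [simp] = is_duality[OF F.target.symmetric_monoidal_closed_category_axioms]
    is_duality[OF F.source.symmetric_monoidal_closed_category_axioms]
    is_duality[OF G.source.symmetric_monoidal_closed_category_axioms] K
  have 1: "dp_functor ?Z (hom_duality ?Z K) ?X (hom_duality ?X (fob (pull P f) (fob (pull P g) K)))
    (dp_comp ?X (pull_dpf B P f (fob (pull P g) K)) (pull_dpf B P g K))"
    by (rule dp_functor_comp[OF _ _ _ G.pull_dp_functor[where K = K] F.pull_dp_functor[where K = "fob (pull P g) K"],
          where E' = "hom_duality ?Y (fob (pull P g) K)"]) simp_all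
  \<comment> \<open>So far the target carries the duality of f*g*K; composing with the change along
    \<open>acomp P g f K\<close> replaces it by that of (gf)*K.\<close>
  have 2: "dp_functor ?Z (hom_duality ?Z K) ?X (hom_duality ?X (fob (pull P (g \<cdot> f)) K))
    (dp_comp ?X (change_dpf ?X (acomp P g f K))
      (dp_comp ?X (pull_dpf B P f (fob (pull P g) K)) (pull_dpf B P g K)))"
    by (rule dp_functor_comp[OF _ _ _ 1 F.target.change_dp_functor[OF a]]) simp_all
  have 3: "dp_functor ?Z (hom_duality ?Z K) ?X (hom_duality ?X (fob (pull P (g \<cdot> f)) K)) (pull_dpf B P (g \<cdot> f) K)"
    by (rule GF.pull_dp_functor[OF K]) simp_all
  show ?thesis
    by (rule acomp_dp_morphism[OF f g K _ _ 2 3]) simp_all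
qed

end

section \<open>Suspended and triangulated pseudo functors\<close>

context suspended_monoidal_pseudo_functor
begin

lemma pull_suspended_closed_monoidal:
  assumes f: "f \<in> hom B X Y"
  shows "suspended_closed_monoidal_functor (fib P Y) (fsusp P Y) (fib P X) (fsusp P X)
    (pull P f) (mcomp P f) (ucomp P f) (pcomm P f)"
proof -
  have "X \<in> Ob B" "Y \<in> Ob B" using f by (auto simp: hom_def)
  then interpret X: suspended_smcc "fib P X" "fsusp P X" + Y: suspended_smcc "fib P Y" "fsusp P Y"
    by (simp_all add: fib_suspended)
  interpret closed_monoidal_functor "fib P Y" "fib P X" "pull P f" "mcomp P f" "ucomp P f"
    by (rule pull_closed_monoidal[OF f])
  show ?thesis by unfold_locales (rule pull_suspended_monoidal[OF f])
qed

theorem pull_suspended_dp_morphism: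
  assumes f: "f \<in> hom B X Y" and g: "g \<in> hom B Y Z" and K: "K \<in> Ob (fib P Z)"
  shows "suspended_dp_morphism (fib P Z) (fsusp P Z) (hom_sduality (fib P Z) (fsusp P Z) K)
    (fib P X) (fsusp P X) (hom_sduality (fib P X) (fsusp P X) (fob (pull P (g \<cdot> f)) K))
    (suspended_dp_comp (fib P X) (change_sdpf (fib P X) (fsusp P X) (acomp P g f K))
      (suspended_dp_comp (fib P X) (pull_sdpf B P f (fob (pull P g) K)) (pull_sdpf B P g K)))
    (pull_sdpf B P (g \<cdot> f) K) (acomp P g f)"
proof -
  let ?X = "fib P X" and ?Y = "fib P Y" and ?Z = "fib P Z"
  let ?SX = "fsusp P X" and ?SY = "fsusp P Y" and ?SZ = "fsusp P Z"
  have gf: "g \<cdot> f \<in> hom B X Z" using cmp_hom[OF f g] .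
  have [simp]: "Dom B f = X" "Cod B f = Y" "Dom B g = Y" "Cod B g = Z" "Dom B (g \<cdot> f) = X" "Cod B (g \<cdot> f) = Z"
    using f g gf by (auto simp: hom_def)
  interpret F: suspended_closed_monoidal_functor ?Y ?SY ?X ?SX "pull P f" "mcomp P f" "ucomp P f" "pcomm P f"
    by (rule pull_suspended_closed_monoidal[OF f])
  interpret G: suspended_closed_monoidal_functor ?Z ?SZ ?Y ?SY "pull P g" "mcomp P g" "ucomp P g" "pcomm P g"
    by (rule pull_suspended_closed_monoidal[OF g])
  interpret GF: suspended_closed_monoidal_functor ?Z ?SZ ?X ?SX
    "pull P (g \<cdot> f)" "mcomp P (g \<cdot> f)" "ucomp P (g \<cdot> f)" "pcomm P (g \<cdot> f)"
    by (rule pull_suspended_closed_monoidal[OF gf])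
  note a = nat_trans_arrow[OF acomp_nat_trans[OF f g] K, simplified]
  note [simp] = F.target.hom_sduality_is_sduality F.source.hom_sduality_is_sduality
    G.source.hom_sduality_is_sduality K
  let ?D = "hom_sduality ?X ?SX (fob (pull P (g \<cdot> f)) K)"
  let ?\<Psi> = "suspended_dp_comp ?X (pull_sdpf B P f (fob (pull P g) K)) (pull_sdpf B P g K)"
  let ?\<Phi> = "suspended_dp_comp ?X (change_sdpf ?X ?SX (acomp P g f K)) ?\<Psi>"
  have 1: "suspended_dp_functor ?Z ?SZ (hom_sduality ?Z ?SZ K)
    ?X ?SX (hom_sduality ?X ?SX (fob (pull P f) (fob (pull P g) K))) ?\<Psi>"
    by (rule suspended_dp_functor_comp[OF _ _ _ G.pull_suspended_dp_functor[where K = K]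
          F.pull_suspended_dp_functor[where K = "fob (pull P g) K"]]) simp_all
  have 2: "suspended_dp_functor ?Z ?SZ (hom_sduality ?Z ?SZ K) ?X ?SX ?D ?\<Phi>"
    by (rule suspended_dp_functor_comp[OF _ _ _ 1 F.target.change_suspended_dp_functor[OF a]]) simp_all
  have 3: "suspended_dp_functor ?Z ?SZ (hom_sduality ?Z ?SZ K) ?X ?SX ?D (pull_sdpf B P (g \<cdot> f) K)"
    by (rule GF.pull_suspended_dp_functor[OF K]) simp_all
  have "dp_morphism ?Z (hom_sduality ?Z ?SZ K) ?X ?D ?\<Phi> (pull_sdpf B P (g \<cdot> f) K) (acomp P g f)"
    by (rule acomp_dp_morphism[OF f g K _ _ suspended_dp_functor_iff[THEN iffD1, THEN conjunct1, OF 2]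
          suspended_dp_functor_iff[THEN iffD1, THEN conjunct1, OF 3]]) simp_all
  \<comment> \<open>\<open>change_sdpf\<close> contributes identities to the commutation isomorphism
    of the composite; removing them leaves the source in the form of
    \<open>acomp_suspended\<close>.\<close>
  moreover have "cmp_comm ?X id_functor (\<lambda>A. Idt ?X (sh\<^sub>o ?SX A)) (pull P f \<circ>\<^sub>F pull P g)
      (cmp_comm ?X (pull P f) (pcomm P f) (pull P g) (pcomm P g)) A =
    cmp_comm ?X (pull P f) (pcomm P f) (pull P g) (pcomm P g) A" if "A \<in> Ob ?Z" for A
    using that by (simp add: cmp_comm_def)
  then have "suspended_nat_trans ?Z ?SZ ?X ?SX (dfun ?\<Phi>) (dcomm ?\<Phi>) (pull P (g \<cdot> f)) (pcomm P (g \<cdot> f)) (acomp P g f)"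
    using acomp_suspended[OF f g] by (simp add: suspended_nat_trans_def)
  ultimately show ?thesis
    using 2 3 by (simp add: suspended_dp_morphism_def)
qed

end

text \<open>Exactness concerns the underlying suspended functors alone, so the suspended statement
  is completed by closure of exact functors under composition, the identity functor of the change
  included.\<close>

theorem (in triangulated_monoidal_pseudo_functor) pull_exact_dp_morphism:
  assumes f: "f \<in> hom B X Y" and g: "g \<in> hom B Y Z" and K: "K \<in> Ob (fib P Z)"
  shows "exact_dp_morphism (fib P Z) (fsusp P Z) (fexact P Z) (hom_sduality (fib P Z) (fsusp P Z) K)
    (fib P X) (fsusp P X) (fexact P X) (hom_sduality (fib P X) (fsusp P X) (fob (pull P (g \<cdot> f)) K))
    (suspended_dp_comp (fib P X) (change_sdpf (fib P X) (fsusp P X) (acomp P g f K))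
      (suspended_dp_comp (fib P X) (pull_sdpf B P f (fob (pull P g) K)) (pull_sdpf B P g K)))
    (pull_sdpf B P (g \<cdot> f) K) (acomp P g f)"
proof -
  have "X \<in> Ob B" "Y \<in> Ob B" "Z \<in> Ob B" using f g by (auto simp: hom_def)
  then interpret X: triangulated_smcc "fib P X" "fsusp P X" "fexact P X" +
    Y: triangulated_smcc "fib P Y" "fsusp P Y" "fexact P Y" +
    Z: triangulated_smcc "fib P Z" "fsusp P Z" "fexact P Z"
    by (simp_all add: fib_triangulated)
  have gf: "g \<cdot> f \<in> hom B X Z" using cmp_hom[OF f g] .
  note m = pull_suspended_dp_morphism[OF f g K]
  have "exact_functor (fib P Z) (fsusp P Z) (fexact P Z) (fib P X) (fsusp P X) (fexact P X)
    (id_functor \<circ>\<^sub>F (pull P f \<circ>\<^sub>F pull P g))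
    (cmp_comm (fib P X) id_functor (\<lambda>A. Idt (fib P X) (sh\<^sub>o (fsusp P X) A)) (pull P f \<circ>\<^sub>F pull P g)
      (cmp_comm (fib P X) (pull P f) (pcomm P f) (pull P g) (pcomm P g)))"
    by (intro exact_functor_cmp[OF exact_functor_cmp[OF pull_exact[OF g] pull_exact[OF f]]]
        exact_functor_id X.triangulated_category_axioms Z.exact_triangles)
  then show ?thesis
    using m pull_exact[OF gf] by (simp add: exact_dp_morphism_def exact_dp_functor_def suspended_dp_morphism_def)
qed

theorem theorem5p1p3:
  fixes B :: "('b, 'f) cat"
    and P :: "('b, 'f, 'o, 'm) pfun"
    and Ps :: "('b, 'f, 'p, 'n) spfun"
    and Pt :: "('b, 'f, 'q, 'l) tpfun"
    and f g :: 'f and X Y Z :: 'b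
  assumes "category B" and "f \<in> hom B X Y" and "g \<in> hom B Y Z"
  shows
    "(monoidal_pseudo_functor B P \<and> associative_pseudo_functor B P \<longrightarrow>
      (\<forall>K \<in> Ob (fib P Z).
        dp_morphism
          (fib P Z) (hom_duality (fib P Z) K)
          (fib P X) (hom_duality (fib P X) (fob (pull P (g \<cdot>\<^bsub>B\<^esub> f)) K))
          (dp_comp (fib P X) (change_dpf (fib P X) (acomp P g f K))
            (dp_comp (fib P X) (pull_dpf B P f (fob (pull P g) K)) (pull_dpf B P g K)))
          (pull_dpf B P (g \<cdot>\<^bsub>B\<^esub> f) K)
          (acomp P g f))) \<and>
     (suspended_monoidal_pseudo_functor B Ps \<and> associative_pseudo_functor B Ps \<longrightarrow>
      (\<forall>K \<in> Ob (fib Ps Z).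
        suspended_dp_morphism
          (fib Ps Z) (fsusp Ps Z) (hom_sduality (fib Ps Z) (fsusp Ps Z) K)
          (fib Ps X) (fsusp Ps X) (hom_sduality (fib Ps X) (fsusp Ps X) (fob (pull Ps (g \<cdot>\<^bsub>B\<^esub> f)) K))
          (suspended_dp_comp (fib Ps X) (change_sdpf (fib Ps X) (fsusp Ps X) (acomp Ps g f K))
            (suspended_dp_comp (fib Ps X) (pull_sdpf B Ps f (fob (pull Ps g) K)) (pull_sdpf B Ps g K)))
          (pull_sdpf B Ps (g \<cdot>\<^bsub>B\<^esub> f) K)
          (acomp Ps g f))) \<and>
     (triangulated_monoidal_pseudo_functor B Pt \<and> associative_pseudo_functor B Pt \<longrightarrow>
      (\<forall>K \<in> Ob (fib Pt Z).
        exact_dp_morphism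
          (fib Pt Z) (fsusp Pt Z) (fexact Pt Z) (hom_sduality (fib Pt Z) (fsusp Pt Z) K)
          (fib Pt X) (fsusp Pt X) (fexact Pt X)
          (hom_sduality (fib Pt X) (fsusp Pt X) (fob (pull Pt (g \<cdot>\<^bsub>B\<^esub> f)) K))
          (suspended_dp_comp (fib Pt X) (change_sdpf (fib Pt X) (fsusp Pt X) (acomp Pt g f K))
            (suspended_dp_comp (fib Pt X) (pull_sdpf B Pt f (fob (pull Pt g) K)) (pull_sdpf B Pt g K)))
          (pull_sdpf B Pt (g \<cdot>\<^bsub>B\<^esub> f) K)
          (acomp Pt g f)))"
  using assms
  by (auto intro: monoidal_pseudo_functor.pull_dp_morphism
      suspended_monoidal_pseudo_functor.pull_suspended_dp_morphism
      triangulated_monoidal_pseudo_functor.pull_exact_dp_morphism)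

end
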